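(* As $n\to\infty$, \[ g_{2,1}(n)\sim\frac{3}{2^{13/4}\pi}n^{-1/4}e^{\frac{\pi}{2}\sqrt n}\qquad\text{and}\qquad g_{2,2}(n)\sim\frac{1}{2^{5/4}\pi}n^{-1/4}e^{\frac{\pi}{2}\sqrt n}. \]
   Context: A partition $\lambda=(\lambda_1\ge \lambda_2\ge\cdots\ge\lambda_k)$ of $n$ is a weakly decreasing sequence of positive integers summing to $n$; its conjugate is $\lambda'$ with $\lambda'_j=\#\{i:\lambda_i\ge j\}$. For the cell in row $i$ and column $j$ of the Young diagram of $\lambda$, its hook length is $h(i,j)=\lambda_i+\lambda'_j-i-j+1$. A $t$-hook is a cell with hook length $t$. For a positive integer $t$, $g_{2,t}(n)$ denotes the total number of $t$-hooks, summed over all partitions of $n$ all of whose parts are congruent to $1$, $5$ or $6$ modulo $8$. *)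

theory Defs
  imports Complex_Main "HOL-Library.Landau_Symbols"
begin

(* Partitions are lists of parts in weakly decreasing order.  Rows and columns of the Young
   diagram are numbered from 1, so the i-th part of xs is xs ! (i - 1). *)

definition is_partition :: "nat list \<Rightarrow> bool" where
  "is_partition xs \<longleftrightarrow> sorted_wrt (\<ge>) xs \<and> (\<forall>k\<in>set xs. 0 < k)"

definition partitions_of :: "nat \<Rightarrow> nat list set" where
  "partitions_of n = {xs. is_partition xs \<and> sum_list xs = n}"

definition part :: "nat list \<Rightarrow> nat \<Rightarrow> nat" where
  "part xs i = xs ! (i - 1)"

definition conj_part :: "nat list \<Rightarrow> nat \<Rightarrow> nat" where
  "conj_part xs j = card {i \<in> {1..length xs}. j \<le> part xs i}"

definition cells :: "nat list \<Rightarrow> (nat \<times> nat) set" where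
  "cells xs = {(i, j). i \<in> {1..length xs} \<and> j \<in> {1..part xs i}}"

definition hook_length :: "nat list \<Rightarrow> nat \<times> nat \<Rightarrow> int" where
  "hook_length xs = (\<lambda>(i, j). int (part xs i) + int (conj_part xs j) - int i - int j + 1)"

definition num_hooks :: "nat \<Rightarrow> nat list \<Rightarrow> nat" where
  "num_hooks t xs = card {c \<in> cells xs. hook_length xs c = int t}"

definition g2 :: "nat \<Rightarrow> nat \<Rightarrow> nat" where
  "g2 t n = (\<Sum>xs | xs \<in> partitions_of n \<and> (\<forall>k\<in>set xs. k mod 8 \<in> {1, 5, 6}).
     num_hooks t xs)"

(* The sum and the cardinality above range over finite sets. *)

lemma finite_partitions_of: "finite (partitions_of n)"
proof (rule finite_subset)
  have len: "length xs \<le> sum_list xs" if "\<forall>k\<in>set xs. 0 < k" for xs :: "nat list"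
    using that by (induction xs) auto
  show "partitions_of n \<subseteq> {xs. set xs \<subseteq> {..n} \<and> length xs \<le> n}"
    using len member_le_sum_list
    by (fastforce simp: partitions_of_def is_partition_def)
  show "finite {xs. set xs \<subseteq> {..n} \<and> length xs \<le> n}"
    by (rule finite_lists_length_le) simp
qed

lemma finite_cells: "finite (cells xs)"
proof -
  have "cells xs = (SIGMA i:{1..length xs}. {1..part xs i})"
    by (auto simp: cells_def)
  then show ?thesis by simp
qed

end

theory Submission
  imports Defs "HOL-Library.Multiset" "HOL-Complex_Analysis.Complex_Analysis"
    "HOL-Real_Asymp.Real_Asymp" "HOL-Probability.Distributions"
begin

text \<open>
  A partition has one 1-hook for each distinct part, and its 2-hooks correspond to the repeated parts
  and to the parts \<open>k \<ge> 2\<close> such that \<open>k - 1\<close> is not a part. Removing the parts in question expresses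
  both hook counts through sums of \<open>p (n - i)\<close> with \<open>i\<close> in arithmetic progressions, where \<open>p (n)\<close> counts the
  admissible partitions of \<open>n\<close>; the generating functions of these sums are \<open>q ^ a / (1 - q ^ d) * P (q)\<close>.
  Euler's device writes \<open>log P\<close> at \<open>q = exp (- z)\<close> as an alternating series, from which
  \<open>P (exp (- z)) = 2 powr (- 1/4) * exp (pi\<^sup>2 / (16 z)) * (1 + o(1))\<close> as \<open>z\<close> tends to 0 in a sector. The coefficients are
  then extracted by Cauchy's integral on the circle through the saddle point \<open>x = pi / (4 sqrt n)\<close>: near the
  real axis the rescaled integrand converges dominatedly to a Gaussian, and on the rest of the circle
  \<open>P\<close> is smaller than \<open>P (exp (- x))\<close> by a factor \<open>exp (- c / x)\<close>.
\<close>

section \<open>Hooks of length one and two\<close>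

text \<open>The delicate point is the factor 2 powr (- 1/4). For fixed m the term
  \<open>gg_series (exp (- m * z)) / m\<close> of log P is 3 / (8 m^2 z) + o(1), since the constant
  coefficients 1/2 - a/8 for a = 1, 5, 6 add up to 0. A termwise limit would thus give the factor 1:
  the missing - ln 2 / 4 comes from m of order 1 / |z|. The alternating form makes it visible, as
  the constant coefficient - 1/4 of \<open>gg_aux\<close> times the alternating harmonic series;
  likewise pi^2 / 16 is the polar coefficient 3/4 times pi^2 / 12. The limiting series converges
  only conditionally, so its terms are dominated in pairs. The arcs are separated at |\<theta>| = x:
  this is wide compared with the Gaussian peak, whose width is of order x powr (3/2), stays inside a
  fixed sector, and is already far enough from the real axis for a loss of order 1 / x in log |P|.
  The pole of q^a / (1 - q^d) at q = 1 depends only on d, so every progression of difference d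
  contributes 2 powr (- 1/4) / (pi d). The constants of the theorem reduce to 3/8 for 1-hooks and
  3/16 + 3/8 - 1/16 = 1/2 for 2-hooks.\<close>

lemma conj_part_conv_length_filter: "conj_part xs j = length (filter (\<lambda>k. j \<le> k) xs)"
proof -
  have "{i \<in> {1..length xs}. j \<le> Defs.part xs i} = Suc ` {i. i < length xs \<and> j \<le> xs ! i}"
  proof (intro equalityI subsetI)
    fix i assume "i \<in> {i \<in> {1..length xs}. j \<le> Defs.part xs i}"
    then show "i \<in> Suc ` {i. i < length xs \<and> j \<le> xs ! i}"
      by (intro image_eqI[of _ _ "i - 1"]) (auto simp: Defs.part_def)
  qed (auto simp: Defs.part_def)
  then show ?thesis
    by (simp add: conj_part_def length_filter_conv_card card_image)
qed

text \<open>Links column heights to multiplicities; this is how conditions on legs become conditions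
  on \<open>mset xs\<close> alone.\<close>

lemma conj_part_Suc: "conj_part xs j = conj_part xs (Suc j) + count (mset xs) j"
  unfolding conj_part_conv_length_filter by (induction xs) auto

lemma conj_part_antimono: "j \<le> k \<Longrightarrow> conj_part xs k \<le> conj_part xs j"
  by (auto simp: conj_part_def intro!: card_mono)

lemma part_antimono:
  assumes "is_partition xs" "1 \<le> a" "a \<le> b" "b \<le> length xs"
  shows "Defs.part xs b \<le> Defs.part xs a"
proof (cases "a = b")
  case False
  then show ?thesis
    using assms sorted_wrt_nth_less[of "(\<ge>)" xs "a - 1" "b - 1"]
    by (auto simp: is_partition_def Defs.part_def)
qed auto

text \<open>The Galois connection between a partition and its conjugate: as the parts decrease, the
  rows reaching column \<open>j\<close> form an initial segment.\<close>

lemma part_ge_iff: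
  assumes "is_partition xs" "1 \<le> i" "i \<le> length xs"
  shows "j \<le> Defs.part xs i \<longleftrightarrow> i \<le> conj_part xs j"
proof
  assume j: "j \<le> Defs.part xs i"
  have "k \<in> {k \<in> {1..length xs}. j \<le> Defs.part xs k}" if "k \<in> {1..i}" for k
    using part_antimono[OF assms(1), of k i] that j assms by auto
  then have "card {1..i} \<le> conj_part xs j"
    unfolding conj_part_def by (intro card_mono) auto
  then show "i \<le> conj_part xs j" by simp
next
  assume i: "i \<le> conj_part xs j"
  show "j \<le> Defs.part xs i"
  proof (rule ccontr)
    assume j: "\<not> j \<le> Defs.part xs i"
    have "k < i" if "k \<in> {1..length xs}" "j \<le> Defs.part xs k" for k
      using part_antimono[OF assms(1), of i k] that j assms by (cases "i \<le> k") auto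
    then have "conj_part xs j \<le> card {1..<i}"
      unfolding conj_part_def by (intro card_mono) auto
    then show False using i assms by simp
  qed
qed

lemma conj_part_le_length: "conj_part xs j \<le> length xs"
  by (simp add: conj_part_conv_length_filter)

text \<open>Arm plus leg plus one, over the naturals: a cell lies within its column as well as
  within its row, so the truncated subtractions are exact.\<close>

lemma hook_length_eq_iff:
  assumes "is_partition xs"
  shows "(i, j) \<in> cells xs \<and> hook_length xs (i, j) = int t \<longleftrightarrow>
    1 \<le> i \<and> i \<le> conj_part xs j \<and> i \<le> length xs \<and> 1 \<le> j \<and> j \<le> Defs.part xs i \<and>
      (Defs.part xs i - j) + (conj_part xs j - i) + 1 = t"
proof (cases "1 \<le> i \<and> i \<le> length xs \<and> 1 \<le> j \<and> j \<le> Defs.part xs i")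
  case True
  then have "i \<le> conj_part xs j" using part_ge_iff[OF assms, of i j] by auto
  with True show ?thesis by (auto simp: cells_def hook_length_def)
qed (auto simp: cells_def)

lemma part_conj_part_eqI:
  assumes "is_partition xs" "1 \<le> i" "i \<le> conj_part xs j" "conj_part xs (Suc j) < i"
  shows "Defs.part xs i = j"
proof -
  have "i \<le> length xs" using assms conj_part_le_length order_trans by blast
  with part_ge_iff[OF assms(1,2), of j] part_ge_iff[OF assms(1,2), of "Suc j"] assms
  show ?thesis by auto
qed

lemma conj_part_part:
  assumes "is_partition xs" "1 \<le> i" "i \<le> length xs" "Defs.part xs i = j"
  shows "i \<le> conj_part xs j" "conj_part xs (Suc j) < i"
  using part_ge_iff[OF assms(1-3), of j] part_ge_iff[OF assms(1-3), of "Suc j"] assms by auto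

text \<open>Arm and leg both vanish exactly at the corners of the diagram, and each block of equal
  parts ends in one corner.\<close>

lemma num_hooks_1:
  assumes "is_partition xs"
  shows "num_hooks 1 xs = card (set xs)"
proof -
  have "{c \<in> cells xs. hook_length xs c = int 1} = (\<lambda>j. (conj_part xs j, j)) ` set xs"
  proof (intro equalityI subsetI)
    fix c assume "c \<in> {c \<in> cells xs. hook_length xs c = int 1}"
    moreover obtain i j where c: "c = (i, j)" by (cases c)
    ultimately have "1 \<le> i" "i \<le> length xs" "Defs.part xs i = j" "conj_part xs j = i"
      using hook_length_eq_iff[OF assms, of i j 1] by auto
    then show "c \<in> (\<lambda>j. (conj_part xs j, j)) ` set xs"
      using c by (auto simp: Defs.part_def intro!: image_eqI)
  next
    fix c assume "c \<in> (\<lambda>j. (conj_part xs j, j)) ` set xs"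
    then obtain j where j: "j \<in> set xs" "c = (conj_part xs j, j)" by auto
    have "count (mset xs) j > 0" using j by auto
    then have less: "conj_part xs (Suc j) < conj_part xs j"
      using conj_part_Suc[of xs j] by auto
    then have "Defs.part xs (conj_part xs j) = j"
      by (intro part_conj_part_eqI assms) auto
    moreover have "1 \<le> j" using j assms by (auto simp: is_partition_def Suc_le_eq)
    ultimately show "c \<in> {c \<in> cells xs. hook_length xs c = int 1}"
      using hook_length_eq_iff[OF assms, of "conj_part xs j" j 1] j less conj_part_le_length[of xs j]
      by auto
  qed
  then show ?thesis
    by (simp add: num_hooks_def card_image inj_on_def)
qed

text \<open>The two summands count the 2-hooks with a cell below and those with a cell to the right.\<close>

lemma num_hooks_2:
  assumes "is_partition xs"
  shows "num_hooks 2 xs = card {j. 2 \<le> count (mset xs) j} + card {k \<in> set xs. 2 \<le> k \<and> k - 1 \<notin> set xs}"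
proof -
  \<comment> \<open>\<open>?A\<close> has arm 0 and leg 1: last column, last row but one of a block
    of equal parts. \<open>?B\<close> has arm 1 and leg 0: last row of the block of
    \<open>k\<close>, column \<open>k - 1\<close>, which is no taller than column \<open>k\<close>
    because \<open>k - 1\<close> is not a part.\<close>
  let ?A = "(\<lambda>j. (conj_part xs j - 1, j)) ` {j. 2 \<le> count (mset xs) j}"
  let ?B = "(\<lambda>k. (conj_part xs k, k - 1)) ` {k \<in> set xs. 2 \<le> k \<and> k - 1 \<notin> set xs}"
  have A: "Defs.part xs (conj_part xs j - 1) = j" "1 \<le> conj_part xs j - 1"
    "conj_part xs j - 1 \<le> length xs" "1 \<le> j" if j: "2 \<le> count (mset xs) j" for j
  proof -
    have less: "conj_part xs (Suc j) + 2 \<le> conj_part xs j"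
      using conj_part_Suc[of xs j] j by auto
    then show "Defs.part xs (conj_part xs j - 1) = j" "1 \<le> conj_part xs j - 1"
      "conj_part xs j - 1 \<le> length xs"
      using conj_part_le_length[of xs j] by (auto intro!: part_conj_part_eqI assms)
    have "j \<in># mset xs" using j by (intro count_inI) auto
    then show "1 \<le> j" using assms by (auto simp: is_partition_def Suc_le_eq)
  qed
  have B: "Defs.part xs (conj_part xs k) = k" "1 \<le> conj_part xs k" "conj_part xs (k - 1) = conj_part xs k"
    if k: "k \<in> set xs" "2 \<le> k" "k - 1 \<notin> set xs" for k
  proof -
    have "count (mset xs) k > 0" using k by auto
    then have less: "conj_part xs (Suc k) < conj_part xs k"
      using conj_part_Suc[of xs k] by auto
    then show "Defs.part xs (conj_part xs k) = k" "1 \<le> conj_part xs k"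
      by (auto intro!: part_conj_part_eqI assms)
    show "conj_part xs (k - 1) = conj_part xs k"
      using conj_part_Suc[of xs "k - 1"] k by (auto simp: count_eq_zero_iff)
  qed
  have "{c \<in> cells xs. hook_length xs c = int 2} = ?A \<union> ?B"
  proof (intro equalityI subsetI)
    fix c assume "c \<in> {c \<in> cells xs. hook_length xs c = int 2}"
    moreover obtain i j where c: "c = (i, j)" by (cases c)
    ultimately have H: "1 \<le> i" "i \<le> length xs" "1 \<le> j" "j \<le> Defs.part xs i" "i \<le> conj_part xs j"
      "(Defs.part xs i - j) + (conj_part xs j - i) + 1 = 2"
      using hook_length_eq_iff[OF assms, of i j 2] by auto
    consider "Defs.part xs i = j" "conj_part xs j = Suc i" | "Defs.part xs i = Suc j" "conj_part xs j = i"
      using H by linarith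
    then show "c \<in> ?A \<union> ?B"
    proof cases
      case 1
      then have "2 \<le> count (mset xs) j"
        using conj_part_part[OF assms H(1,2) 1(1)] conj_part_Suc[of xs j] by auto
      then show ?thesis using 1 c by (auto intro!: image_eqI)
    next
      case 2
      have "Suc j \<in> set xs" using 2 H by (auto simp: Defs.part_def intro!: nth_mem simp flip: 2(1))
      moreover have "conj_part xs (Suc j) = i"
        using conj_part_part[OF assms H(1,2) 2(1)] conj_part_antimono[of j "Suc j" xs] 2 by auto
      moreover have "j \<notin> set xs"
        using calculation conj_part_Suc[of xs j] 2 by (auto simp flip: count_mset_0_iff)
      ultimately show ?thesis using c H by (auto intro!: image_eqI[of _ _ "Suc j"])
    qed
  next
    fix c assume "c \<in> ?A \<union> ?B"
    then show "c \<in> {c \<in> cells xs. hook_length xs c = int 2}"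
    proof
      assume "c \<in> ?A"
      then obtain j where j: "2 \<le> count (mset xs) j" "c = (conj_part xs j - 1, j)" by auto
      then show ?thesis using A[OF j(1)]
          hook_length_eq_iff[OF assms, of "conj_part xs j - 1" j 2] by auto
    next
      assume "c \<in> ?B"
      then obtain k where k: "k \<in> set xs" "2 \<le> k" "k - 1 \<notin> set xs" "c = (conj_part xs k, k - 1)"
        by auto
      then show ?thesis using B[OF k(1-3)] conj_part_le_length[of xs k]
          hook_length_eq_iff[OF assms, of "conj_part xs k" "k - 1" 2] by auto
    qed
  qed
  moreover have "?A \<inter> ?B = {}"
  proof (intro equals0I)
    fix c assume "c \<in> ?A \<inter> ?B"
    then obtain j k where "2 \<le> count (mset xs) j" "k \<in> set xs" "2 \<le> k" "k - 1 \<notin> set xs"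
      "j = k - 1" "conj_part xs j - 1 = conj_part xs k" by auto
    then show False using A[of j] B[of k] by auto
  qed
  moreover have "inj_on (\<lambda>j. (conj_part xs j - 1, j)) {j. 2 \<le> count (mset xs) j}"
    by (auto simp: inj_on_def)
  moreover have "inj_on (\<lambda>k. (conj_part xs k, k - 1)) {k \<in> set xs. 2 \<le> k \<and> k - 1 \<notin> set xs}"
    by (auto simp: inj_on_def)
  moreover have "finite {j. 2 \<le> count (mset xs) j}"
    by (rule finite_subset[of _ "set_mset (mset xs)"])
      (auto simp del: set_mset_mset simp flip: count_greater_zero_iff)
  ultimately show ?thesis
    by (simp add: num_hooks_def card_Un_disjoint card_image)
qed

section \<open>Partitions with prescribed parts\<close>

text \<open>Multisets replace sorted lists so that removing parts is plain subtraction.\<close>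

definition mset_partitions :: "nat set \<Rightarrow> nat \<Rightarrow> nat multiset set" where
  "mset_partitions S n = {M. set_mset M \<subseteq> S \<and> sum_mset M = n}"

definition num_partitions :: "nat set \<Rightarrow> nat \<Rightarrow> nat" where
  "num_partitions S n = card (mset_partitions S n)"

lemma bij_betw_mset_partitions:
  assumes "0 \<notin> S"
  shows "bij_betw mset {xs \<in> partitions_of n. set xs \<subseteq> S} (mset_partitions S n)"
proof (rule bij_betwI')
  fix xs ys assume "xs \<in> {xs \<in> partitions_of n. set xs \<subseteq> S}" "ys \<in> {xs \<in> partitions_of n. set xs \<subseteq> S}"
  then have "sorted (rev xs)" "sorted (rev ys)"
    by (auto simp: partitions_of_def is_partition_def sorted_wrt_rev)
  then have "rev xs = rev ys" if "mset xs = mset ys"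
    using that by (metis mset_rev properties_for_sort)
  then show "(mset xs = mset ys) = (xs = ys)" by auto
next
  fix M assume M: "M \<in> mset_partitions S n"
  define xs where "xs = rev (sorted_list_of_multiset M)"
  have xs: "mset xs = M" by (simp add: xs_def)
  moreover have "sorted_wrt (\<ge>) xs" by (simp add: xs_def sorted_wrt_rev)
  moreover have "sum_list xs = n" "set xs \<subseteq> S"
    using M xs by (auto simp: mset_partitions_def sum_mset_sum_list[symmetric])
  ultimately show "\<exists>xs\<in>{xs \<in> partitions_of n. set xs \<subseteq> S}. M = mset xs"
    using assms by (intro bexI[of _ xs]) (auto simp: partitions_of_def is_partition_def intro!: gr0I)
qed (auto simp: partitions_of_def mset_partitions_def sum_mset_sum_list)

lemma finite_mset_partitions: "0 \<notin> S \<Longrightarrow> finite (mset_partitions S n)"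
  using bij_betw_finite[OF bij_betw_mset_partitions[of S n]] finite_partitions_of[of n] by simp

lemma card_mset_partitions_subset:
  assumes "set_mset D \<subseteq> S"
  shows "card {M \<in> mset_partitions S n. D \<subseteq># M} =
    (if sum_mset D \<le> n then num_partitions S (n - sum_mset D) else 0)"
proof (cases "sum_mset D \<le> n")
  case True
  have "bij_betw (\<lambda>M. M + D) (mset_partitions S (n - sum_mset D)) {M \<in> mset_partitions S n. D \<subseteq># M}"
    by (rule bij_betw_byWitness[of _ "\<lambda>M. M - D"])
      (use True assms in \<open>auto simp: mset_partitions_def sum_mset_diff dest: in_diffD\<close>)
  then show ?thesis
    using True bij_betw_same_card by (fastforce simp: num_partitions_def)
next
  case False
  have "sum_mset D \<le> sum_mset M" if "D \<subseteq># M" for M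
    using that by (metis le_add1 subset_mset.add_diff_inverse sum_mset.union)
  then have "{M \<in> mset_partitions S n. D \<subseteq># M} = {}"
    using False by (auto simp: mset_partitions_def)
  then show ?thesis using False by (simp only: card.empty if_False)
qed

text \<open>The coefficient of q^n in the product of the indicator series of \<open>A\<close> with
  the generating function of \<open>p\<close>.\<close>

definition shift_sum :: "nat set \<Rightarrow> (nat \<Rightarrow> nat) \<Rightarrow> nat \<Rightarrow> nat" where
  "shift_sum A p n = (\<Sum>i\<le>n. if i \<in> A then p (n - i) else 0)"

lemma shift_sum_Un: "A \<inter> B = {} \<Longrightarrow> shift_sum (A \<union> B) p n = shift_sum A p n + shift_sum B p n"
  unfolding shift_sum_def sum.distrib[symmetric] by (intro sum.cong) auto

lemma shift_sum_Un3:
  assumes "A \<inter> B = {}" "A \<inter> C = {}" "B \<inter> C = {}"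
  shows "shift_sum (A \<union> B \<union> C) p n = shift_sum A p n + shift_sum B p n + shift_sum C p n"
  using assms by (simp add: shift_sum_Un Int_Un_distrib2)

text \<open>Double counting: for each \<open>k\<close>, removing \<open>D k\<close> is a bijection
  onto the partitions of the remaining weight. Injectivity of the weight allows the removed weight
  itself to serve as summation index.\<close>

lemma sum_card_submultisets:
  assumes "0 \<notin> S" and D: "\<And>k. k \<in> K \<Longrightarrow> set_mset (D k) \<subseteq> S"
    and inj: "inj_on (\<lambda>k. sum_mset (D k)) K"
  shows "(\<Sum>M\<in>mset_partitions S n. card {k \<in> K. D k \<subseteq># M}) =
    shift_sum ((\<lambda>k. sum_mset (D k)) ` K) (num_partitions S) n"
proof -
  let ?s = "\<lambda>k. sum_mset (D k)"
  \<comment> \<open>\<open>K\<close> may be infinite; a submultiset of a partition of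
    \<open>n\<close> weighs at most \<open>n\<close>, and by injectivity only finitely many
    \<open>k\<close> qualify.\<close>
  define K' where "K' = {k \<in> K. ?s k \<le> n}"
  have inj': "inj_on ?s K'" using inj by (rule inj_on_subset) (auto simp: K'_def)
  have fin: "finite K'"
    by (rule inj_on_finite[OF inj', of "{..n}"]) (auto simp: K'_def)
  have le: "sum_mset E \<le> sum_mset M" if "E \<subseteq># M" for E M :: "nat multiset"
    using that by (metis le_add1 subset_mset.add_diff_inverse sum_mset.union)
  have "(\<Sum>M\<in>mset_partitions S n. card {k \<in> K. D k \<subseteq># M}) =
      (\<Sum>M\<in>mset_partitions S n. \<Sum>k\<in>K'. if D k \<subseteq># M then 1 else 0)"
  proof (intro sum.cong refl)
    fix M assume "M \<in> mset_partitions S n"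
    then have "{k \<in> K. D k \<subseteq># M} = {k \<in> K'. D k \<subseteq># M}"
      using le[of _ M] by (auto simp: K'_def mset_partitions_def)
    then show "card {k \<in> K. D k \<subseteq># M} = (\<Sum>k\<in>K'. if D k \<subseteq># M then 1 else 0)"
      by (simp add: sum.If_cases fin Int_def)
  qed
  also have "\<dots> = (\<Sum>k\<in>K'. card {M \<in> mset_partitions S n. D k \<subseteq># M})"
    by (subst sum.swap) (simp add: sum.If_cases finite_mset_partitions[OF assms(1)] Int_def)
  also have "\<dots> = (\<Sum>k\<in>K'. num_partitions S (n - ?s k))"
    by (intro sum.cong refl) (auto simp: K'_def card_mset_partitions_subset D)
  also have "\<dots> = (\<Sum>i\<in>?s ` K'. num_partitions S (n - i))"
    by (simp add: sum.reindex[OF inj'])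
  also have "?s ` K' = {i \<in> {..n}. i \<in> ?s ` K}" by (auto simp: K'_def)
  also have "(\<Sum>i\<in>\<dots>. num_partitions S (n - i)) = shift_sum (?s ` K) (num_partitions S) n"
    unfolding shift_sum_def by (rule sum.inter_filter) simp
  finally show ?thesis .
qed

definition progr :: "nat \<Rightarrow> nat \<Rightarrow> nat set" where "progr a d = range (\<lambda>j. a + d * j)"

lemma progr_eq_mod: "a < d \<Longrightarrow> progr a d = {k. k mod d = a}"
  by (auto simp: progr_def image_iff) (metis mod_mult_div_eq)

lemma image_double_progr: "(\<lambda>k. k + k) ` progr a d = progr (2 * a) (2 * d)"
  by (auto simp: progr_def image_image intro!: image_cong)

lemma progr_rec: "progr a d = insert a (progr (a + d) d)"
proof (intro equalityI subsetI)
  fix i assume "i \<in> progr a d"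
  then obtain j where "i = a + d * j" by (auto simp: progr_def)
  then show "i \<in> insert a (progr (a + d) d)"
    by (cases j) (auto simp: progr_def)
next
  fix i assume "i \<in> insert a (progr (a + d) d)"
  then consider "i = a + d * 0" | j where "i = a + d * Suc j" by (force simp: progr_def)
  then show "i \<in> progr a d" unfolding progr_def by cases blast+
qed

lemma progr_disjoint: "a mod d \<noteq> b mod d \<Longrightarrow> progr a d \<inter> progr b d = {}"
  by (auto simp: progr_def) (metis mod_mult_self2)

section \<open>Hook counts over the admissible parts as shifted partition sums\<close>

definition gg_parts :: "nat set" where "gg_parts = {k. k mod 8 \<in> {1, 5, 6}}"

lemma gg_parts_eq: "gg_parts = progr 1 8 \<union> progr 5 8 \<union> progr 6 8"
  by (auto simp: gg_parts_def progr_eq_mod)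

lemma zero_notin_gg_parts [simp]: "0 \<notin> gg_parts" by (simp add: gg_parts_def)

lemma g2_conv_mset:
  assumes "\<And>xs. is_partition xs \<Longrightarrow> num_hooks t xs = f (mset xs)"
  shows "g2 t n = (\<Sum>M\<in>mset_partitions gg_parts n. f M)"
proof -
  have "g2 t n = (\<Sum>xs\<in>{xs \<in> partitions_of n. set xs \<subseteq> gg_parts}. f (mset xs))"
    unfolding g2_def gg_parts_def
    by (intro sum.cong) (auto simp: assms partitions_of_def)
  also have "\<dots> = (\<Sum>M\<in>mset_partitions gg_parts n. f M)"
    by (rule sum.reindex_bij_betw[OF bij_betw_mset_partitions]) simp
  finally show ?thesis .
qed

abbreviation "gg_sum a d \<equiv> shift_sum (progr a d) (num_partitions gg_parts)"

text \<open>Removing one copy of each distinct part in turn makes the removed weights range over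
  \<open>gg_parts\<close>.\<close>

lemma g2_1: "g2 1 n = gg_sum 1 8 n + gg_sum 5 8 n + gg_sum 6 8 n"
proof -
  have "g2 1 n = (\<Sum>M\<in>mset_partitions gg_parts n. card (set_mset M))"
    by (rule g2_conv_mset) (subst num_hooks_1, auto)
  also have "\<dots> = (\<Sum>M\<in>mset_partitions gg_parts n. card {k \<in> gg_parts. {#k#} \<subseteq># M})"
    by (intro sum.cong refl arg_cong[of _ _ card]) (auto simp: mset_partitions_def)
  also have "\<dots> = shift_sum gg_parts (num_partitions gg_parts) n"
    by (subst sum_card_submultisets) auto
  also have "shift_sum gg_parts (num_partitions gg_parts) n =
      shift_sum (progr 1 8 \<union> progr 5 8 \<union> progr 6 8) (num_partitions gg_parts) n"
    by (subst (1) gg_parts_eq) simp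
  also have "shift_sum (progr 1 8 \<union> progr 5 8 \<union> progr 6 8) (num_partitions gg_parts) n = gg_sum 1 8 n + gg_sum 5 8 n + gg_sum 6 8 n"
    by (rule shift_sum_Un3; simp add: progr_disjoint)
  finally show ?thesis .
qed

text \<open>Repeated parts have two copies removed, with weights in 2, 10, 12 mod 16. The parts
  \<open>k \<ge> 2\<close> with \<open>k - 1\<close> absent are all parts other than 1, hence the
  progression from 9 instead of 1, minus those with \<open>k - 1\<close> present. Consecutive
  admissible numbers are only 5, 6 mod 8, and removing such a pair takes weight 11 mod 16; this
  negative term stands on the left to stay within the naturals.\<close>

lemma g2_2:
  "g2 2 n + gg_sum 11 16 n = gg_sum 2 16 n + gg_sum 10 16 n + gg_sum 12 16 n +
     gg_sum 9 8 n + gg_sum 5 8 n + gg_sum 6 8 n"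
proof -
  let ?P = "mset_partitions gg_parts n" and ?p = "num_partitions gg_parts"
  let ?C = "\<lambda>K D M. card {k \<in> K. D k \<subseteq># (M :: nat multiset)}"
  define K1 where "K1 = {k \<in> gg_parts. 2 \<le> k}"
  define K2 where "K2 = progr 6 8"
  have "g2 2 n = (\<Sum>M\<in>?P. card {j. 2 \<le> count M j} + card {k \<in> set_mset M. 2 \<le> k \<and> k - 1 \<notin> set_mset M})"
    by (rule g2_conv_mset) (simp add: num_hooks_2)
  also have "\<dots> + (\<Sum>M\<in>?P. ?C K2 (\<lambda>k. {#k, k - 1#}) M) =
      (\<Sum>M\<in>?P. ?C gg_parts (\<lambda>k. {#k, k#}) M + ?C K1 (\<lambda>k. {#k#}) M)"
    unfolding sum.distrib[symmetric]
  proof (intro sum.cong refl)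
    fix M assume "M \<in> ?P"
    then have M: "set_mset M \<subseteq> gg_parts" by (simp add: mset_partitions_def)
    have sub: "{#k, l#} \<subseteq># M \<longleftrightarrow> k \<in># M \<and> l \<in># M" if "k \<noteq> l" for k l
      using that by (auto simp: insert_subset_eq_iff in_diff_count)
    have sub2: "{#k, k#} \<subseteq># M \<longleftrightarrow> 2 \<le> count M k" for k
      by (auto simp: subseteq_mset_def split: if_splits)
    have "{j. 2 \<le> count M j} = {k \<in> gg_parts. {#k, k#} \<subseteq># M}"
      unfolding sub2 using M by (auto intro!: subsetD[OF M] count_inI)
    moreover have "{k \<in> set_mset M. 2 \<le> k \<and> k - 1 \<in> set_mset M} = {k \<in> K2. {#k, k - 1#} \<subseteq># M}"
    proof (intro equalityI subsetI)
      fix k assume "k \<in> {k \<in> set_mset M. 2 \<le> k \<and> k - 1 \<in> set_mset M}"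
      moreover from this M have "k \<in> gg_parts" "k - 1 \<in> gg_parts" "2 \<le> k" by auto
      then have "k \<in> K2"
        by (cases k) (auto simp: gg_parts_def K2_def progr_eq_mod mod_Suc split: if_splits)
      ultimately show "k \<in> {k \<in> K2. {#k, k - 1#} \<subseteq># M}"
        using sub[of k "k - 1"] by (simp, linarith)
    next
      fix k assume k: "k \<in> {k \<in> K2. {#k, k - 1#} \<subseteq># M}"
      then have "k \<in> K2" by blast
      then have "2 \<le> k" by (auto simp: K2_def progr_def)
      then show "k \<in> {k \<in> set_mset M. 2 \<le> k \<and> k - 1 \<in> set_mset M}"
        using k sub[of k "k - 1"] by simp
    qed
    moreover have "{k \<in> set_mset M. 2 \<le> k \<and> k - 1 \<notin> set_mset M} \<union>
        {k \<in> set_mset M. 2 \<le> k \<and> k - 1 \<in> set_mset M} = {k \<in> K1. {#k#} \<subseteq># M}"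
      using M by (auto simp: K1_def)
    then have "card {k \<in> set_mset M. 2 \<le> k \<and> k - 1 \<notin> set_mset M} +
        card {k \<in> set_mset M. 2 \<le> k \<and> k - 1 \<in> set_mset M} = card {k \<in> K1. {#k#} \<subseteq># M}"
      by (subst card_Un_disjoint[symmetric]) auto
    ultimately show "card {j. 2 \<le> count M j} + card {k \<in> set_mset M. 2 \<le> k \<and> k - 1 \<notin> set_mset M} +
        ?C K2 (\<lambda>k. {#k, k - 1#}) M = ?C gg_parts (\<lambda>k. {#k, k#}) M + ?C K1 (\<lambda>k. {#k#}) M"
      by simp
  qed
  also have "(\<Sum>M\<in>?P. ?C K2 (\<lambda>k. {#k, k - 1#}) M) = shift_sum ((\<lambda>k. k + (k - 1)) ` K2) ?p n"
  proof (subst sum_card_submultisets)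
    show "set_mset {#k, k - 1#} \<subseteq> gg_parts" if "k \<in> K2" for k
      using that by (cases k) (auto simp: gg_parts_def K2_def progr_eq_mod mod_Suc split: if_splits)
    show "inj_on (\<lambda>k. sum_mset {#k, k - 1#}) K2" by (auto simp: inj_on_def)
  qed auto
  also have "(\<lambda>k. k + (k - 1)) ` K2 = progr 11 16"
    by (auto simp: K2_def progr_def image_image intro!: image_cong)
  also have "(\<Sum>M\<in>?P. ?C gg_parts (\<lambda>k. {#k, k#}) M + ?C K1 (\<lambda>k. {#k#}) M) =
      shift_sum ((\<lambda>k. k + k) ` gg_parts) ?p n + shift_sum K1 ?p n"
    unfolding sum.distrib
    by (subst (1 2) sum_card_submultisets) (auto simp: inj_on_def K1_def)
  also have "(\<lambda>k. k + k) ` gg_parts = progr 2 16 \<union> progr 10 16 \<union> progr 12 16"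
    by (simp add: gg_parts_eq image_Un image_double_progr)
  also have "shift_sum (progr 2 16 \<union> progr 10 16 \<union> progr 12 16) ?p n =
      gg_sum 2 16 n + gg_sum 10 16 n + gg_sum 12 16 n"
    by (rule shift_sum_Un3; simp add: progr_disjoint)
  also have "K1 = progr 9 8 \<union> progr 5 8 \<union> progr 6 8"
  proof -
    have "progr 1 8 = insert 1 (progr 9 8)"
      using progr_rec[of 1 8] by simp
    then show ?thesis by (auto simp: K1_def gg_parts_eq) (auto simp: progr_def)
  qed
  also have "shift_sum \<dots> ?p n = gg_sum 9 8 n + gg_sum 5 8 n + gg_sum 6 8 n"
    by (rule shift_sum_Un3; simp add: progr_disjoint)
  finally show ?thesis by simp
qed

section \<open>Generating functions\<close>

lemma progr_sums:
  fixes q :: "'a :: {real_normed_field, banach}"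
  assumes "norm q < 1" "0 < d"
  shows "(\<lambda>i. if i \<in> progr a d then q ^ i else 0) sums (q ^ a / (1 - q ^ d))"
proof -
  have "norm (q ^ d) < 1" using assms by (simp add: norm_power power_less_one_iff)
  then have "(\<lambda>j. q ^ a * (q ^ d) ^ j) sums (q ^ a * (1 / (1 - q ^ d)))"
    by (intro sums_mult geometric_sums)
  moreover have "strict_mono (\<lambda>j. a + d * j)" using assms by (auto simp: strict_mono_def)
  moreover have "a + d * j \<in> progr a d" for j unfolding progr_def by (rule rangeI)
  ultimately show ?thesis
    by (subst sums_mono_reindex[of "\<lambda>j. a + d * j", symmetric])
      (auto simp: power_add power_mult, auto simp: progr_def)
qed

lemma summable_norm_progr:
  fixes q :: "'a :: {real_normed_field, banach}"
  assumes "norm q < 1" "0 < d"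
  shows "summable (\<lambda>i. norm (if i \<in> progr a d then q ^ i else 0))"
proof -
  have "(\<lambda>i. norm (if i \<in> progr a d then q ^ i else 0)) = (\<lambda>i. if i \<in> progr a d then norm q ^ i else 0)"
    by (auto simp: norm_power)
  then show ?thesis
    using progr_sums[of "norm q" d a] assms by (simp add: sums_iff)
qed

lemma shift_sum_sums:
  fixes q :: "'a :: {real_normed_field, banach}"
  assumes "norm q < 1" "0 < d" and p: "summable (\<lambda>n. norm (of_nat (p n) * q ^ n))"
  shows "(\<lambda>n. of_nat (shift_sum (progr a d) p n) * q ^ n) sums
    (q ^ a / (1 - q ^ d) * (\<Sum>n. of_nat (p n) * q ^ n))"
proof -
  have "(\<lambda>n. \<Sum>i\<le>n. (if i \<in> progr a d then q ^ i else 0) * (of_nat (p (n - i)) * q ^ (n - i))) sums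
      ((\<Sum>i. if i \<in> progr a d then q ^ i else 0) * (\<Sum>n. of_nat (p n) * q ^ n))"
    by (intro Cauchy_product_sums p summable_norm_progr assms)
  also have "(\<Sum>i. if i \<in> progr a d then q ^ i else 0) = q ^ a / (1 - q ^ d)"
    using progr_sums[OF assms(1,2)] by (simp add: sums_iff)
  also have "(\<lambda>n. \<Sum>i\<le>n. (if i \<in> progr a d then q ^ i else 0) * (of_nat (p (n - i)) * q ^ (n - i))) =
      (\<lambda>n. of_nat (shift_sum (progr a d) p n) * q ^ n)"
    unfolding shift_sum_def of_nat_sum sum_distrib_right
    by (intro ext sum.cong) (auto simp: power_add[symmetric])
  finally show ?thesis .
qed

text \<open>Either \<open>k\<close> does not occur or one copy of it can be removed: the recurrence
  behind the factor 1 / (1 - q^k).\<close>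

lemma num_partitions_insert:
  assumes "0 \<notin> S" "0 < k" "k \<notin> S"
  shows "num_partitions (insert k S) n =
    num_partitions S n + (if k \<le> n then num_partitions (insert k S) (n - k) else 0)"
proof -
  have fin: "finite (mset_partitions (insert k S) n)" "finite (mset_partitions S n)"
    using assms by (auto intro!: finite_mset_partitions)
  have "mset_partitions (insert k S) n =
      mset_partitions S n \<union> {M \<in> mset_partitions (insert k S) n. {#k#} \<subseteq># M}"
    by (auto simp: mset_partitions_def)
  moreover have "mset_partitions S n \<inter> {M \<in> mset_partitions (insert k S) n. {#k#} \<subseteq># M} = {}"
    using assms by (auto simp: mset_partitions_def)
  ultimately have "num_partitions (insert k S) n =
      num_partitions S n + card {M \<in> mset_partitions (insert k S) n. {#k#} \<subseteq># M}"
    using fin unfolding num_partitions_def by (metis (no_types, lifting) card_Un_disjoint finite_Un)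
  then show ?thesis by (subst (asm) card_mset_partitions_subset) auto
qed

lemma shift_sum_progr_add:
  "shift_sum (progr (a + k) d) p n = (if k \<le> n then shift_sum (progr a d) p (n - k) else 0)"
proof -
  have "shift_sum (progr (a + k) d) p n = (\<Sum>i | i \<le> n \<and> i \<in> progr (a + k) d. p (n - i))"
    unfolding shift_sum_def by (subst sum.If_cases) (auto simp: Int_def)
  also have "\<dots> = (\<Sum>i \<in> (\<lambda>i. i + k) ` {i. i + k \<le> n \<and> i \<in> progr a d}. p (n - i))"
    by (intro sum.cong) (auto simp: progr_def image_iff algebra_simps)
  also have "\<dots> = (\<Sum>i | i + k \<le> n \<and> i \<in> progr a d. p (n - (i + k)))"
    by (subst sum.reindex) auto
  also have "\<dots> = (if k \<le> n then shift_sum (progr a d) p (n - k) else 0)"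
  proof (cases "k \<le> n")
    case True
    then show ?thesis
      unfolding shift_sum_def by (subst sum.If_cases) (auto intro!: sum.cong simp: algebra_simps)
  qed (auto intro!: sum.neutral)
  finally show ?thesis .
qed

lemma shift_sum_progr_rec:
  assumes "0 < d"
  shows "shift_sum (progr 0 d) p n = p n + (if d \<le> n then shift_sum (progr 0 d) p (n - d) else 0)"
proof -
  have "shift_sum {0} p n = p n"
    unfolding shift_sum_def by simp
  moreover have "progr 0 d = {0} \<union> progr (0 + d) d" using progr_rec[of 0 d] by simp
  moreover have "{0} \<inter> progr (0 + d) d = {}" using assms by (auto simp: progr_def)
  ultimately have "shift_sum (progr 0 d) p n = p n + shift_sum (progr (0 + d) d) p n"
    by (metis shift_sum_Un)
  then show ?thesis by (simp only: shift_sum_progr_add)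
qed

text \<open>Both sides satisfy the recurrence f(n) = p(n) + f(n - k), where p counts the partitions
  with parts in \<open>S\<close>.\<close>

lemma num_partitions_insert_conv_shift_sum:
  assumes "0 \<notin> S" "0 < k" "k \<notin> S"
  shows "num_partitions (insert k S) n = shift_sum (progr 0 k) (num_partitions S) n"
proof (induction n rule: less_induct)
  case (less n)
  show ?case
    using less[of "n - k"] assms
    by (subst num_partitions_insert[OF assms], subst shift_sum_progr_rec[OF assms(2)]) auto
qed

text \<open>The coefficients are nonnegative, so convergence at the real point \<open>norm q\<close>
  is already absolute convergence at \<open>q\<close>.\<close>

lemma summable_norm_of_nat_power:
  fixes q :: complex
  assumes "\<And>q :: complex. norm q < 1 \<Longrightarrow> summable (\<lambda>n. of_nat (c n) * q ^ n)" "norm q < 1"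
  shows "summable (\<lambda>n. norm (of_nat (c n) * q ^ n))"
proof -
  have "summable (\<lambda>n. complex_of_real (of_nat (c n) * norm q ^ n))"
    using assms(1)[of "of_real (norm q)"] assms(2) by simp
  then show ?thesis by (simp only: norm_mult norm_power norm_of_nat summable_complex_of_real)
qed

lemma num_partitions_finite_sums:
  fixes q :: complex
  assumes "finite K" "0 \<notin> K" "norm q < 1"
  shows "(\<lambda>n. of_nat (num_partitions K n) * q ^ n) sums (\<Prod>k\<in>K. 1 / (1 - q ^ k))"
  using assms
proof (induction K arbitrary: q rule: finite_induct)
  case empty
  have "mset_partitions {} n = (if n = 0 then {{#}} else {})" for n
    by (auto simp: mset_partitions_def)
  then have "num_partitions {} n = (if n = 0 then 1 else 0)" for n
    by (simp add: num_partitions_def)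
  then have "(\<lambda>n. of_nat (num_partitions {} n) * q ^ n) = (\<lambda>n. if n = 0 then 1 else 0)"
    by auto
  then show ?case using sums_If_finite[of "\<lambda>n. n = 0" "\<lambda>_. 1 :: complex"] by simp
next
  case (insert k K)
  have sum: "summable (\<lambda>n. of_nat (num_partitions K n) * q ^ n)" if "norm q < 1" for q :: complex
    using insert.IH[OF _ that] insert.prems by (auto simp: sums_iff)
  have "(\<lambda>n. of_nat (shift_sum (progr 0 k) (num_partitions K) n) * q ^ n) sums
      (q ^ 0 / (1 - q ^ k) * (\<Sum>n. of_nat (num_partitions K n) * q ^ n))"
    using insert.prems by (intro shift_sum_sums summable_norm_of_nat_power sum) auto
  also have "(\<Sum>n. of_nat (num_partitions K n) * q ^ n) = (\<Prod>k\<in>K. 1 / (1 - q ^ k))"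
    using insert.IH[of q] insert.prems by (auto simp: sums_iff)
  finally show ?case
    using insert by (simp add: num_partitions_insert_conv_shift_sum)
qed

definition gg_series :: "complex \<Rightarrow> complex" where
  "gg_series y = (y + y ^ 5 + y ^ 6) / (1 - y ^ 8)"

text \<open>The sum of - log (1 - q^k) over the admissible k, expanded in powers and with the sum
  over k carried out first. Being a series, it fixes a logarithm of the Euler product without any
  choice of branch.\<close>

definition gg_log :: "complex \<Rightarrow> complex" where
  "gg_log q = (\<Sum>m. gg_series (q ^ Suc m) / of_nat (Suc m))"

lemma gg_series_sums:
  assumes "norm y < 1"
  shows "(\<lambda>i. if i \<in> gg_parts then y ^ i else 0) sums gg_series y"
proof -
  have "(\<lambda>i. (if i \<in> progr 1 8 then y ^ i else 0) + (if i \<in> progr 5 8 then y ^ i else 0) +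
      (if i \<in> progr 6 8 then y ^ i else 0)) sums
      (y ^ 1 / (1 - y ^ 8) + y ^ 5 / (1 - y ^ 8) + y ^ 6 / (1 - y ^ 8))"
    by (intro sums_add progr_sums assms) auto
  also have "(\<lambda>i. (if i \<in> progr 1 8 then y ^ i else 0) + (if i \<in> progr 5 8 then y ^ i else 0) +
      (if i \<in> progr 6 8 then y ^ i else 0)) = (\<lambda>i. if i \<in> gg_parts then y ^ i else 0)"
    by (auto simp: gg_parts_eq progr_eq_mod)
  finally show ?thesis by (simp add: gg_series_def add_divide_distrib)
qed

text \<open>Uniform in the cutoff \<open>N\<close> and proportional to \<open>norm y\<close>: with a
  power of \<open>q\<close> for \<open>y\<close> it gives the geometric majorant for exchanging
  limit and sum.\<close>

lemma norm_sum_gg_parts_le: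
  fixes y :: complex
  assumes "norm y \<le> r" "r < 1"
  shows "norm (\<Sum>k\<in>gg_parts \<inter> {..N}. y ^ k) \<le> norm y / (1 - r)"
proof -
  have r: "0 \<le> r" using assms(1) norm_ge_zero order_trans by blast
  have "norm (\<Sum>k\<in>gg_parts \<inter> {..N}. y ^ k) \<le> (\<Sum>k\<in>gg_parts \<inter> {..N}. norm y ^ k)"
    by (rule sum_norm_le) (simp add: norm_power)
  also have "\<dots> \<le> (\<Sum>k=1..N. norm y ^ k)"
    by (rule sum_mono2) (auto simp: gg_parts_def intro!: Suc_leI gr0I)
  also have "\<dots> = norm y * (\<Sum>k<N. norm y ^ k)"
    by (simp add: sum_distrib_left sum.atLeast1_atMost_eq)
  also have "(\<Sum>k<N. norm y ^ k) \<le> (\<Sum>k<N. r ^ k)"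
    by (intro sum_mono power_mono assms) auto
  also have "(\<Sum>k<N. r ^ k) \<le> (\<Sum>k. r ^ k)"
    using r assms by (intro sum_le_suminf) auto
  also have "\<dots> = 1 / (1 - r)" using r assms by (simp add: suminf_geometric)
  finally show ?thesis by (simp add: mult_left_mono)
qed

lemma norm_gg_series_le:
  assumes "norm y \<le> r" "r < 1"
  shows "norm (gg_series y) \<le> norm y / (1 - r)"
proof (rule tendsto_upperbound)
  have "(\<lambda>N. \<Sum>i\<le>N. if i \<in> gg_parts then y ^ i else 0) \<longlonglongrightarrow> gg_series y"
    using gg_series_sums[of y] assms by (simp add: sums_def_le)
  then show "(\<lambda>N. norm (\<Sum>i\<le>N. if i \<in> gg_parts then y ^ i else 0)) \<longlonglongrightarrow> norm (gg_series y)"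
    by (rule tendsto_norm)
  have "(\<Sum>i\<le>N. if i \<in> gg_parts then y ^ i else 0) = (\<Sum>k\<in>gg_parts \<inter> {..N}. y ^ k)" for N
    by (simp add: sum.If_cases Int_commute Collect_mem_eq)
  then show "\<forall>\<^sub>F N in sequentially. norm (\<Sum>i\<le>N. if i \<in> gg_parts then y ^ i else 0) \<le> norm y / (1 - r)"
    using norm_sum_gg_parts_le[OF assms] by simp
qed simp

lemma summable_gg_log:
  assumes "norm q < 1"
  shows "summable (\<lambda>m. norm (gg_series (q ^ Suc m) / of_nat (Suc m)))"
proof (rule summable_comparison_test'[where N = 0])
  show "summable (\<lambda>m. norm q / (1 - norm q) * norm q ^ m)"
    using assms by (intro summable_mult summable_geometric) auto
  fix m :: nat
  have "norm (q ^ Suc m) \<le> norm q"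
    using assms by (simp add: norm_mult norm_power mult_left_le power_le_one)
  then have "norm (gg_series (q ^ Suc m)) \<le> norm (q ^ Suc m) / (1 - norm q)"
    using assms by (intro norm_gg_series_le)
  moreover have "norm (gg_series (q ^ Suc m)) / real (Suc m) \<le> norm (gg_series (q ^ Suc m)) / 1"
    by (intro divide_left_mono) auto
  ultimately show "norm (norm (gg_series (q ^ Suc m) / of_nat (Suc m))) \<le> norm q / (1 - norm q) * norm q ^ m"
    by (simp add: norm_divide norm_mult norm_power del: of_nat_Suc)
qed

text \<open>For finitely many parts the logarithmic series can be added up and exponentiated to the
  product; Tannery's theorem then lets the cutoff tend to infinity inside the sum over m.\<close>

lemma tendsto_prod_gg_parts:
  assumes "norm q < 1"
  shows "(\<lambda>N. \<Prod>k\<in>gg_parts \<inter> {..N}. 1 / (1 - q ^ k)) \<longlonglongrightarrow> exp (gg_log q)"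
proof -
  let ?a = "\<lambda>m N. (\<Sum>k\<in>gg_parts \<inter> {..N}. (q ^ Suc m) ^ k) / of_nat (Suc m)"
  have qm: "norm (q ^ Suc m) \<le> norm q" for m
    using assms by (simp add: norm_mult norm_power mult_left_le power_le_one)
  have "(\<lambda>N. \<Sum>m. ?a m N) \<longlonglongrightarrow> gg_log q"
    unfolding gg_log_def
  proof (rule tannerys_theorem[THEN conjunct2, THEN conjunct2])
    fix m
    have "norm (q ^ Suc m) < 1" using qm[of m] assms by linarith
    then have "(\<lambda>N. \<Sum>i\<le>N. if i \<in> gg_parts then (q ^ Suc m) ^ i else 0) \<longlonglongrightarrow> gg_series (q ^ Suc m)"
      using gg_series_sums by (simp add: sums_def_le del: power_Suc)
    then have "(\<lambda>N. \<Sum>k\<in>gg_parts \<inter> {..N}. (q ^ Suc m) ^ k) \<longlonglongrightarrow> gg_series (q ^ Suc m)"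
      by (simp add: sum.If_cases Int_commute Collect_mem_eq del: power_Suc)
    then show "?a m \<longlonglongrightarrow> gg_series (q ^ Suc m) / of_nat (Suc m)"
      by (intro tendsto_divide tendsto_const) (auto simp del: of_nat_Suc)
  next
    show "summable (\<lambda>m. norm q / (1 - norm q) * norm q ^ m)"
      using assms by (intro summable_mult summable_geometric) auto
    show "\<forall>\<^sub>F (m, N) in sequentially \<times>\<^sub>F sequentially.
        norm (?a m N) \<le> norm q / (1 - norm q) * norm q ^ m"
    proof (intro always_eventually allI, clarify)
      fix m N :: nat
      have "norm (\<Sum>k\<in>gg_parts \<inter> {..N}. (q ^ Suc m) ^ k) \<le> norm (q ^ Suc m) / (1 - norm q)"
        using assms qm by (intro norm_sum_gg_parts_le)
      moreover have "norm (\<Sum>k\<in>gg_parts \<inter> {..N}. (q ^ Suc m) ^ k) / real (Suc m) \<le>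
          norm (\<Sum>k\<in>gg_parts \<inter> {..N}. (q ^ Suc m) ^ k) / 1"
        by (intro divide_left_mono) auto
      moreover have "norm (?a m N) = norm (\<Sum>k\<in>gg_parts \<inter> {..N}. (q ^ Suc m) ^ k) / real (Suc m)"
        by (simp only: norm_divide norm_of_nat)
      moreover have "norm (q ^ Suc m) / (1 - norm q) = norm q / (1 - norm q) * norm q ^ m"
        by (simp add: norm_mult norm_power)
      ultimately show "norm (?a m N) \<le> norm q / (1 - norm q) * norm q ^ m" by linarith
    qed
  qed simp
  then have "(\<lambda>N. exp (\<Sum>m. ?a m N)) \<longlonglongrightarrow> exp (gg_log q)"
    by (rule tendsto_exp)
  moreover have "exp (\<Sum>m. ?a m N) = (\<Prod>k\<in>gg_parts \<inter> {..N}. 1 / (1 - q ^ k))" for N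
  proof -
    have qk: "norm (q ^ k) < 1" if "k \<in> gg_parts" for k
      using assms that by (auto simp: norm_power power_less_one_iff gg_parts_def intro!: gr0I)
    have "(\<lambda>m. (q ^ Suc m) ^ k / of_nat (Suc m)) sums (- Ln (1 - q ^ k))" if "k \<in> gg_parts" for k
    proof -
      have "(\<lambda>m. - ((- (- (q ^ k))) ^ m) / of_nat m) sums Ln (1 + (- (q ^ k)))"
        using qk[OF that] by (intro Ln_series') simp
      then have "(\<lambda>m. - (- ((- (- (q ^ k))) ^ m) / of_nat m)) sums (- Ln (1 + (- (q ^ k))))"
        by (rule sums_minus)
      then have "(\<lambda>m. (q ^ k) ^ m / of_nat m) sums (- Ln (1 - q ^ k))"
        by simp
      \<comment> \<open>The term dropped at index 0 is 1 / 0, which is 0 by convention.\<close>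
      then have "(\<lambda>m. (q ^ k) ^ Suc m / of_nat (Suc m)) sums (- Ln (1 - q ^ k))"
        by (subst sums_Suc_iff) simp
      then show ?thesis by (simp only: power_mult[symmetric] mult.commute)
    qed
    then have "(\<lambda>m. \<Sum>k\<in>gg_parts \<inter> {..N}. (q ^ Suc m) ^ k / of_nat (Suc m)) sums
        (\<Sum>k\<in>gg_parts \<inter> {..N}. - Ln (1 - q ^ k))"
      by (intro sums_sum) auto
    then have "(\<Sum>m. ?a m N) = (\<Sum>k\<in>gg_parts \<inter> {..N}. - Ln (1 - q ^ k))"
      by (simp only: sum_divide_distrib sums_iff)
    also have "exp \<dots> = (\<Prod>k\<in>gg_parts \<inter> {..N}. exp (- Ln (1 - q ^ k)))"
      by (rule exp_sum) simp
    also have "\<dots> = (\<Prod>k\<in>gg_parts \<inter> {..N}. 1 / (1 - q ^ k))"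
    proof (intro prod.cong refl)
      fix k assume "k \<in> gg_parts \<inter> {..N}"
      then have "1 - q ^ k \<noteq> 0" using qk[of k] by auto
      then show "exp (- Ln (1 - q ^ k)) = 1 / (1 - q ^ k)"
        by (simp add: exp_minus divide_inverse)
    qed
    finally show ?thesis .
  qed
  ultimately show ?thesis by simp
qed

section \<open>From finitely many parts to all admissible parts\<close>

lemma num_partitions_mono:
  assumes "S \<subseteq> T" "0 \<notin> T"
  shows "num_partitions S n \<le> num_partitions T n"
  unfolding num_partitions_def
  by (rule card_mono[OF finite_mset_partitions[OF assms(2)]]) (use assms in \<open>auto simp: mset_partitions_def\<close>)

lemma num_partitions_restrict:
  assumes "n \<le> N"
  shows "num_partitions (S \<inter> {..N}) n = num_partitions S n"
proof -
  have "x \<le> N" if "x \<in># M" "sum_mset M = n" for x M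
    using that assms by (auto dest!: multi_member_split)
  then have "mset_partitions (S \<inter> {..N}) n = mset_partitions S n"
    by (auto simp: mset_partitions_def)
  then show ?thesis by (simp add: num_partitions_def)
qed

text \<open>Up to index \<open>N\<close> the coefficients agree with those of the product over parts
  up to \<open>N\<close>. By nonnegativity the partial sum is at most that product, and the products
  are bounded because they converge.\<close>

lemma summable_gg_gf:
  assumes "0 \<le> r" "r < 1"
  shows "summable (\<lambda>n. real (num_partitions gg_parts n) * r ^ n)"
proof -
  have "convergent (\<lambda>N. \<Prod>k\<in>gg_parts \<inter> {..N}. 1 / (1 - complex_of_real r ^ k))"
    using tendsto_prod_gg_parts[of "of_real r"] assms by (auto simp: convergent_def)
  then obtain B where B: "norm (\<Prod>k\<in>gg_parts \<inter> {..N}. 1 / (1 - complex_of_real r ^ k)) \<le> B" for N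
    using convergent_imp_Bseq BseqE by metis
  show ?thesis
  proof (rule summableI_nonneg_bounded)
    fix N
    have sums: "(\<lambda>n. complex_of_real (real (num_partitions (gg_parts \<inter> {..N}) n) * r ^ n)) sums
        (\<Prod>k\<in>gg_parts \<inter> {..N}. 1 / (1 - complex_of_real r ^ k))"
      using num_partitions_finite_sums[of "gg_parts \<inter> {..N}" "of_real r"] assms by simp
    then have "summable (\<lambda>n. complex_of_real (real (num_partitions (gg_parts \<inter> {..N}) n) * r ^ n))"
      by (simp only: sums_iff)
    then have summ: "summable (\<lambda>n. real (num_partitions (gg_parts \<inter> {..N}) n) * r ^ n)"
      by (simp only: summable_complex_of_real)
    have "(\<Sum>n<N. real (num_partitions gg_parts n) * r ^ n) =
        (\<Sum>n<N. real (num_partitions (gg_parts \<inter> {..N}) n) * r ^ n)"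
      by (intro sum.cong) (simp_all add: num_partitions_restrict)
    also have "\<dots> \<le> (\<Sum>n. real (num_partitions (gg_parts \<inter> {..N}) n) * r ^ n)"
      using assms by (intro sum_le_suminf summ) auto
    also have "\<dots> \<le> norm (complex_of_real (\<Sum>n. real (num_partitions (gg_parts \<inter> {..N}) n) * r ^ n))"
      by (simp only: norm_of_real abs_ge_self)
    also have "complex_of_real (\<Sum>n. real (num_partitions (gg_parts \<inter> {..N}) n) * r ^ n) =
        (\<Prod>k\<in>gg_parts \<inter> {..N}. 1 / (1 - complex_of_real r ^ k))"
      using sums summ by (metis sums_of_real sums_unique2 summable_sums)
    finally show "(\<Sum>n<N. real (num_partitions gg_parts n) * r ^ n) \<le> B"
      using B[of N] by linarith
  qed (use assms in auto)
qed

lemma gg_gf_sums: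
  fixes q :: complex
  assumes "norm q < 1"
  shows "(\<lambda>n. of_nat (num_partitions gg_parts n) * q ^ n) sums exp (gg_log q)"
proof -
  have summ: "summable (\<lambda>n. norm (of_nat (num_partitions gg_parts n) * q ^ n))"
    using summable_gg_gf[of "norm q"] assms by (simp add: norm_mult norm_power)
  have "(\<lambda>N. \<Sum>n. of_nat (num_partitions (gg_parts \<inter> {..N}) n) * q ^ n)
      \<longlonglongrightarrow> (\<Sum>n. of_nat (num_partitions gg_parts n) * q ^ n)"
  proof (rule tannerys_theorem[THEN conjunct2, THEN conjunct2])
    fix n
    have "\<forall>\<^sub>F N in sequentially. of_nat (num_partitions gg_parts n) * q ^ n =
        of_nat (num_partitions (gg_parts \<inter> {..N}) n) * q ^ n"
      using eventually_ge_at_top[of n] by eventually_elim (simp add: num_partitions_restrict)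
    then show "(\<lambda>N. of_nat (num_partitions (gg_parts \<inter> {..N}) n) * q ^ n) \<longlonglongrightarrow>
        of_nat (num_partitions gg_parts n) * q ^ n"
      by (rule Lim_transform_eventually[OF tendsto_const])
  next
    show "\<forall>\<^sub>F (n, N) in sequentially \<times>\<^sub>F sequentially.
        norm (of_nat (num_partitions (gg_parts \<inter> {..N}) n) * q ^ n) \<le>
        norm (of_nat (num_partitions gg_parts n) * q ^ n)"
      by (intro always_eventually)
        (auto simp: norm_mult intro!: mult_right_mono num_partitions_mono)
  qed (use summ in simp_all)
  moreover have "(\<Sum>n. of_nat (num_partitions (gg_parts \<inter> {..N}) n) * q ^ n) =
      (\<Prod>k\<in>gg_parts \<inter> {..N}. 1 / (1 - q ^ k))" for N
    using num_partitions_finite_sums[of "gg_parts \<inter> {..N}" q] assms by (simp add: sums_iff)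
  ultimately have "(\<Sum>n. of_nat (num_partitions gg_parts n) * q ^ n) = exp (gg_log q)"
    using tendsto_prod_gg_parts[OF assms] by (simp add: LIMSEQ_unique)
  then show ?thesis using summable_norm_cancel[OF summ] by (simp add: sums_iff)
qed

lemma gg_sum_gf_sums:
  fixes q :: complex
  assumes "norm q < 1" "0 < d"
  shows "(\<lambda>n. of_nat (gg_sum a d n) * q ^ n) sums (q ^ a / (1 - q ^ d) * exp (gg_log q))"
proof -
  have "summable (\<lambda>n. norm (of_nat (num_partitions gg_parts n) * q ^ n))"
    using gg_gf_sums assms by (intro summable_norm_of_nat_power) (auto simp: sums_iff)
  then show ?thesis
    using shift_sum_sums[OF assms, of "num_partitions gg_parts" a] gg_gf_sums[OF assms(1)]
    by (simp add: sums_iff)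
qed

section \<open>Asymptotics of the generating function at 1\<close>

text \<open>The cone |arg w| \<le> pi / 4. It is convex, invariant under positive scaling, so that
  it contains all multiples m z with z, and it meets the line Re w = x exactly in the major arc |Im
  w| \<le> x.\<close>

definition sector :: "complex set" where
  "sector = {w. 0 < Re w \<and> \<bar>Im w\<bar> \<le> Re w}"

text \<open>Chosen so that the sum over \<open>gg_parts\<close> is \<open>gg_aux w - gg_aux (2 * w)\<close>. Hence \<open>gg_log (exp (- z))\<close>
  becomes an alternating series in \<open>gg_aux (m * z) / m\<close>, whose limit as \<open>z\<close> tends to \<open>0\<close> is governed
  by the first two Laurent coefficients of \<open>gg_aux\<close> at \<open>0\<close>.\<close>

definition gg_aux :: "complex \<Rightarrow> complex" where
  "gg_aux w = (exp (- w) + exp (- 2 * w) + exp (- 4 * w)) / (1 - exp (- 4 * w))"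

text \<open>The polar part at 0 is removed: there the numerator of \<open>gg_aux\<close> tends to 3
  and its denominator behaves like 4 w.\<close>

definition gg_rem :: "complex \<Rightarrow> complex" where
  "gg_rem w = gg_aux w - 3 / (4 * w)"

lemma convex_sector: "convex sector"
proof -
  have "sector = {w. Re w > 0} \<inter> ({w. Re w - Im w \<ge> 0} \<inter> {w. Re w + Im w \<ge> 0})"
    by (auto simp: sector_def)
  moreover have "convex {w. Re w - Im w \<ge> 0}" "convex {w. Re w + Im w \<ge> 0}"
    by (auto simp: convex_def scaleR_conv_of_real algebra_simps
        intro!: add_mono mult_left_mono) (smt (verit) distrib_left mult_left_mono)+
  moreover have "convex {w. Re w > 0}" by (rule convex_halfspace_Re_gt)
  ultimately show ?thesis by (metis convex_Int)
qed

lemma norm_le_of_sector: "w \<in> sector \<Longrightarrow> norm w \<le> 2 * Re w"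
  using cmod_le[of w] by (auto simp: sector_def)

lemma scale_sector: "w \<in> sector \<Longrightarrow> 0 < c \<Longrightarrow> of_real c * w \<in> sector"
  by (auto simp: sector_def abs_mult)

lemma at_within_sector_neq_bot: "at 0 within sector \<noteq> bot"
proof -
  have "\<exists>y\<in>sector - {0}. dist y 0 < e" if "e > 0" for e
    using that by (intro bexI[of _ "of_real (e / 2)"]) (auto simp: sector_def dist_norm)
  then show ?thesis by (simp add: at_within_eq_bot_iff closure_approachable)
qed

text \<open>Exponents 1, 2, 4 mod 4 are 1, 2, 4, 5, 6, 8 mod 8; taking away the doubled progressions
  2, 4, 8 mod 8 leaves 1, 5, 6.\<close>

lemma gg_series_exp:
  assumes "Re w > 0"
  shows "gg_series (exp (- w)) = gg_aux w - gg_aux (2 * w)"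
proof -
  define q where "q = exp (- w)"
  have e: "exp (- (of_nat k * w)) = q ^ k" for k
    by (simp add: q_def exp_of_nat_mult[symmetric])
  have q: "norm q < 1" using assms by (simp add: q_def)
  have ne: "1 - q ^ k \<noteq> 0" if "k > 0" for k
  proof -
    have "norm (q ^ k) < 1" using q that by (simp add: norm_power power_less_one_iff)
    then show ?thesis by auto
  qed
  have "gg_aux w = (q + q ^ 2 + q ^ 4) / (1 - q ^ 4)"
    using e[of 1] e[of 2] e[of 4] by (simp add: gg_aux_def)
  also have "\<dots> = (q + q ^ 2 + q ^ 4) * (1 + q ^ 4) / (1 - q ^ 8)"
  proof -
    have "1 - q ^ 8 = (1 - q ^ 4) * (1 + q ^ 4)" by (simp add: algebra_simps flip: power_add)
    then show ?thesis using ne[of 8] ne[of 4] by simp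
  qed
  moreover have "gg_aux (2 * w) = (q ^ 2 + q ^ 4 + q ^ 8) / (1 - q ^ 8)"
    using e[of 2] e[of 4] e[of 8] by (simp add: gg_aux_def mult.assoc[symmetric])
  moreover have "(q + q ^ 2 + q ^ 4) * (1 + q ^ 4) - (q ^ 2 + q ^ 4 + q ^ 8) = q + q ^ 5 + q ^ 6"
    by algebra
  ultimately have "gg_aux w - gg_aux (2 * w) = gg_series q"
    by (simp add: gg_series_def diff_divide_distrib[symmetric])
  then show ?thesis by (simp add: q_def)
qed

text \<open>The zeros are the integer multiples of i pi / 2, and 3/2 is just below pi / 2; any
  radius between 1 and pi / 2 would serve.\<close>

lemma exp_minus_4_neq_1:
  fixes w :: complex
  assumes "norm w < 3 / 2" "w \<noteq> 0"
  shows "1 - exp (- 4 * w) \<noteq> 0"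
proof
  assume "1 - exp (- 4 * w) = 0"
  then have "exp (- 4 * w) = 1" by simp
  then obtain n :: int where n: "Re (- 4 * w) = 0" "Im (- 4 * w) = of_int (2 * n) * pi"
    unfolding exp_eq_1 by blast
  then have "n \<noteq> 0" using assms(2) by (auto simp: complex_eq_iff)
  then have "1 \<le> \<bar>real_of_int n\<bar>" by linarith
  then have "1 * pi \<le> \<bar>real_of_int n\<bar> * pi" by (intro mult_right_mono) auto
  moreover have "4 * \<bar>Im w\<bar> = 2 * (\<bar>real_of_int n\<bar> * pi)"
  proof -
    have "4 * \<bar>Im w\<bar> = \<bar>- 4 * Im w\<bar>" by simp
    also have "- 4 * Im w = of_int (2 * n) * pi" using n(2) by simp
    also have "\<bar>\<dots>\<bar> = 2 * (\<bar>real_of_int n\<bar> * pi)" by (simp add: abs_mult)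
    finally show ?thesis .
  qed
  ultimately show False using abs_Im_le_cmod[of w] assms(1) pi_gt3 by linarith
qed

text \<open>The singularity is removable because \<open>w * gg_rem w\<close> tends to 0. Once the
  extension is continuous, its value at 0 can be computed along the positive reals; it is the sum of
  1/2 - a/4 over a = 1, 2, 4.\<close>

lemma gg_rem_extend:
  obtains g where "g holomorphic_on ball 0 (3 / 2)" "\<And>w. w \<in> ball 0 (3 / 2) - {0} \<Longrightarrow> g w = gg_rem w"
    "g 0 = - 1 / 4"
proof -
  have hol: "gg_rem holomorphic_on ball 0 (3 / 2) - {0}"
    unfolding gg_rem_def gg_aux_def using exp_minus_4_neq_1
    by (intro holomorphic_intros) auto
  have "((\<lambda>w. - exp (- 4 * w)) has_field_derivative 4) (at (0 :: complex))"
    by (auto intro!: derivative_eq_intros)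
  then have "((\<lambda>w. (1 - exp (- 4 * w)) / w) \<longlongrightarrow> 4) (at (0 :: complex))"
    by (simp add: DERIV_def)
  moreover have "((\<lambda>w. exp (- w) + exp (- 2 * w) + exp (- 4 * w)) \<longlongrightarrow> 3) (at (0 :: complex))"
    by (auto intro!: tendsto_eq_intros)
  ultimately have "((\<lambda>w. (exp (- w) + exp (- 2 * w) + exp (- 4 * w)) / ((1 - exp (- 4 * w)) / w) - 3 / 4)
      \<longlongrightarrow> 3 / 4 - 3 / 4) (at (0 :: complex))"
    by (intro tendsto_intros) auto
  moreover have "\<forall>\<^sub>F w in at 0. (exp (- w) + exp (- 2 * w) + exp (- 4 * w)) / ((1 - exp (- 4 * w)) / w) - 3 / 4
      = (w - 0) * gg_rem w"
    unfolding eventually_at_filter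
    by (intro always_eventually) (auto simp: gg_rem_def gg_aux_def right_diff_distrib mult.commute)
  ultimately have "((\<lambda>w. (w - 0) * gg_rem w) \<longlongrightarrow> 0) (at 0)"
    by (simp add: Lim_transform_eventually)
  then obtain g where g: "g holomorphic_on ball 0 (3 / 2)"
      "\<And>w. w \<in> ball 0 (3 / 2) - {0} \<Longrightarrow> g w = gg_rem w"
    using holomorphic_on_extend_lim[OF hol] by auto
  have "isCont g 0"
    using g(1) holomorphic_on_imp_continuous_on continuous_on_interior by fastforce
  then have "(g \<longlongrightarrow> g 0) (at 0)" by (simp add: isCont_def)
  moreover have "filterlim complex_of_real (at 0) (at_right 0)"
    unfolding filterlim_at by (auto intro!: tendsto_eq_intros simp: eventually_at_filter)
  ultimately have "((\<lambda>x. g (of_real x)) \<longlongrightarrow> g 0) (at_right 0)"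
    by (rule filterlim_compose)
  moreover have "\<forall>\<^sub>F x in at_right 0. g (of_real x) = complex_of_real
      ((exp (- x) + exp (- 2 * x) + exp (- 4 * x)) / (1 - exp (- 4 * x)) - 3 / (4 * x))"
  proof -
    have "\<forall>\<^sub>F x in at_right (0 :: real). x < 3 / 2" by real_asymp
    moreover have "\<forall>\<^sub>F x in at_right (0 :: real). 0 < x" by real_asymp
    ultimately show ?thesis
    proof eventually_elim
      case (elim x)
      then have "g (of_real x) = gg_rem (of_real x)" by (intro g) auto
      also have "\<dots> = complex_of_real
          ((exp (- x) + exp (- 2 * x) + exp (- 4 * x)) / (1 - exp (- 4 * x)) - 3 / (4 * x))"
        by (simp add: gg_rem_def gg_aux_def flip: exp_of_real)
      finally show ?case .
    qed
  qed
  ultimately have "((\<lambda>x. complex_of_real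
      ((exp (- x) + exp (- 2 * x) + exp (- 4 * x)) / (1 - exp (- 4 * x)) - 3 / (4 * x))) \<longlongrightarrow> g 0) (at_right 0)"
    by (rule Lim_transform_eventually)
  moreover have "((\<lambda>x :: real. (exp (- x) + exp (- 2 * x) + exp (- 4 * x)) / (1 - exp (- 4 * x)) - 3 / (4 * x))
      \<longlongrightarrow> - 1 / 4) (at_right 0)"
    by real_asymp
  then have "((\<lambda>x. complex_of_real
      ((exp (- x) + exp (- 2 * x) + exp (- 4 * x)) / (1 - exp (- 4 * x)) - 3 / (4 * x)))
      \<longlongrightarrow> of_real (- 1 / 4)) (at_right 0)"
    by (rule tendsto_of_real)
  ultimately have "g 0 = of_real (- 1 / 4)"
    by (intro tendsto_unique[OF trivial_limit_at_right_real])
  then show ?thesis using that[OF g] by simp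
qed

lemma tendsto_gg_rem: "(gg_rem \<longlongrightarrow> - 1 / 4) (at 0)"
proof -
  obtain g where g: "g holomorphic_on ball 0 (3 / 2)" "\<And>w. w \<in> ball 0 (3 / 2) - {0} \<Longrightarrow> g w = gg_rem w"
    "g 0 = - 1 / 4"
    using gg_rem_extend by blast
  have "isCont g 0"
    using g(1) holomorphic_on_imp_continuous_on continuous_on_interior by fastforce
  then have "(g \<longlongrightarrow> - 1 / 4) (at 0)" by (simp add: isCont_def g)
  moreover have "\<forall>\<^sub>F w in at 0. g w = gg_rem w"
    using g(2) eventually_at_in_open[of "ball 0 (3 / 2)" "0 :: complex"] by (auto elim: eventually_mono)
  ultimately show ?thesis by (rule Lim_transform_eventually)
qed

text \<open>In this region \<open>Re w\<close> is at least half of \<open>norm w\<close>, hence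
  |q^4| \<le> exp (- 2) and the denominator is at least 1/2 in modulus. The constants are crude: 13
  = 12 + 1 and 63 = 14 + 48 + 1, the last summand coming from the polar part.\<close>

lemma gg_rem_far:
  assumes "w \<in> sector" "norm w \<ge> 1"
  shows "norm (gg_rem w) \<le> 13 / norm w"
    "\<exists>D. (gg_rem has_field_derivative D) (at w) \<and> norm D \<le> 63"
proof -
  have Re: "Re w \<ge> 1 / 2" "norm w \<le> 2 * Re w" using norm_le_of_sector[OF assms(1)] assms(2) by auto
  have w: "w \<noteq> 0" using assms by auto
  define q where "q = exp (- w)"
  have e: "exp (- (of_nat k * w)) = q ^ k" for k
    by (simp add: q_def exp_of_nat_mult[symmetric])
  have e': "exp (- (2 * w)) = q ^ 2" "exp (- (4 * w)) = q ^ 4" using e[of 2] e[of 4] by auto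
  have nq: "norm q = exp (- Re w)" by (simp add: q_def)
  have "1 + Re w \<le> exp (Re w)" by (rule exp_ge_add_one_self)
  then have "Re w \<le> exp (Re w)" by linarith
  then have q1: "norm q \<le> 1 / Re w" using Re unfolding nq exp_minus by (simp add: field_simps)
  have q: "norm q \<le> 1" unfolding nq using Re by simp
  have qk: "norm (q ^ k) \<le> norm q" if "k > 0" for k
    unfolding norm_power using q that by (intro power_le_one_iff[THEN iffD2] power_decreasing[of 1 k "norm q", simplified]) auto
  have q4: "norm (q ^ 4) \<le> 1 / 2"
  proof -
    have "norm (q ^ 4) = exp (- (4 * Re w))" unfolding norm_power nq by (simp flip: exp_of_nat_mult)
    also have "\<dots> \<le> exp (- 2)" using Re by simp
    also have "\<dots> \<le> 1 / 2" using exp_ge_add_one_self[of 2] by (simp add: exp_minus field_simps)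
    finally show ?thesis .
  qed
  have d: "norm (1 - q ^ 4) \<ge> 1 / 2"
    using norm_triangle_ineq2[of 1 "q ^ 4"] q4 by simp
  have ne: "1 - q ^ 4 \<noteq> 0" using d by auto
  have N: "norm (q + q ^ 2 + q ^ 4) \<le> 3 * norm q"
    using norm_triangle_ineq[of "q + q ^ 2" "q ^ 4"] norm_triangle_ineq[of q "q ^ 2"] qk[of 2] qk[of 4] by linarith
  have "norm (gg_aux w) = norm (q + q ^ 2 + q ^ 4) / norm (1 - q ^ 4)"
    by (simp add: gg_aux_def norm_divide e' flip: q_def)
  also have "\<dots> \<le> (3 * norm q) / (1 / 2)"
    using N d by (intro frac_le) auto
  also have "\<dots> \<le> 6 * (1 / Re w)" using q1 by simp
  also have "\<dots> \<le> 12 / norm w" using Re w by (simp add: field_simps)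
  finally have "norm (gg_aux w) \<le> 12 / norm w" .
  moreover have "norm (3 / (4 * w)) \<le> 1 / norm w"
    by (simp add: norm_divide norm_mult divide_simps)
  ultimately show "norm (gg_rem w) \<le> 13 / norm w"
    unfolding gg_rem_def using norm_triangle_ineq4[of "gg_aux w" "3 / (4 * w)"]
      add_divide_distrib[of 12 1 "norm w"] by simp
  let ?D = "((- q - 2 * q ^ 2 - 4 * q ^ 4) * (1 - q ^ 4) - (q + q ^ 2 + q ^ 4) * (4 * q ^ 4)) / (1 - q ^ 4) ^ 2
      + 3 / (4 * w ^ 2)"
  have dexp: "((\<lambda>w. exp (c * w)) has_field_derivative c * exp (c * w)) (at w)" for c :: complex
    by (auto intro!: derivative_eq_intros)
  have dN: "((\<lambda>w. exp (- w) + exp (- 2 * w) + exp (- 4 * w)) has_field_derivative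
      - exp (- w) + (- 2) * exp (- 2 * w) + (- 4) * exp (- 4 * w)) (at w)"
    using DERIV_add[OF DERIV_add[OF dexp[of "- 1"] dexp[of "- 2"]] dexp[of "- 4"]] by simp
  have dD: "((\<lambda>w. 1 - exp (- 4 * w)) has_field_derivative 0 - (- 4) * exp (- 4 * w)) (at w)"
    by (intro DERIV_diff DERIV_const dexp)
  have "1 - exp (- 4 * w) \<noteq> 0" using ne by (simp add: e')
  from DERIV_divide[OF dN dD this]
  have "(gg_aux has_field_derivative ((- q - 2 * q ^ 2 - 4 * q ^ 4) * (1 - q ^ 4) -
      (q + q ^ 2 + q ^ 4) * (4 * q ^ 4)) / ((1 - q ^ 4) * (1 - q ^ 4))) (at w)"
    unfolding gg_aux_def[abs_def] by (simp add: e' q_def[symmetric])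
  moreover have "((\<lambda>w. 3 / (4 * w)) has_field_derivative (- 3 / (4 * w ^ 2))) (at w)"
    using w by (auto intro!: derivative_eq_intros simp: power2_eq_square)
  ultimately have "(gg_rem has_field_derivative ((- q - 2 * q ^ 2 - 4 * q ^ 4) * (1 - q ^ 4) -
      (q + q ^ 2 + q ^ 4) * (4 * q ^ 4)) / ((1 - q ^ 4) * (1 - q ^ 4)) - (- 3 / (4 * w ^ 2))) (at w)"
    unfolding gg_rem_def[abs_def] by (rule DERIV_diff)
  then have "(gg_rem has_field_derivative ?D) (at w)" by (simp add: power2_eq_square)
  moreover have "norm ?D \<le> 63"
  proof -
    let ?N = "- q - 2 * q ^ 2 - 4 * q ^ 4" and ?M = "(q + q ^ 2 + q ^ 4) * (4 * q ^ 4)"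
    have "?D = ?N / (1 - q ^ 4) - ?M / (1 - q ^ 4) ^ 2 + 3 / (4 * w ^ 2)"
      using ne by (simp add: diff_divide_distrib power2_eq_square)
    then have "norm ?D \<le> norm (?N / (1 - q ^ 4)) + norm (?M / (1 - q ^ 4) ^ 2) + norm (3 / (4 * w ^ 2))"
      by (simp only: order_trans[OF norm_triangle_ineq add_right_mono[OF norm_triangle_ineq4]])
    moreover have "norm (?N / (1 - q ^ 4)) \<le> 7 / (1 / 2)"
    proof -
      have "norm ?N \<le> norm (- q - 2 * q ^ 2) + norm (4 * q ^ 4)"
        by (rule norm_triangle_ineq4)
      moreover have "norm (- q - 2 * q ^ 2) \<le> norm (- q) + norm (2 * q ^ 2)"
        by (rule norm_triangle_ineq4)
      moreover have "norm (2 * q ^ 2) \<le> 2" "norm (4 * q ^ 4) \<le> 4" "norm (- q) \<le> 1"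
        using q qk[of 2] qk[of 4] by (simp_all add: norm_mult)
      ultimately have "norm ?N \<le> 7" by linarith
      then show ?thesis unfolding norm_divide using d by (intro frac_le) auto
    qed
    moreover have "norm (?M / (1 - q ^ 4) ^ 2) \<le> (3 * 4) / (1 / 2) ^ 2"
      unfolding norm_divide norm_mult[of "q + q ^ 2 + q ^ 4"] norm_power[of "1 - q ^ 4"]
    proof (intro frac_le mult_mono power_mono d)
      show "norm (q + q ^ 2 + q ^ 4) \<le> 3" using N q by linarith
      show "norm (4 * q ^ 4) \<le> 4" using qk[of 4] q by (simp add: norm_mult)
    qed (use d in auto)
    moreover have "norm (3 / (4 * w ^ 2)) \<le> 1"
    proof -
      have "1 \<le> norm w ^ 2" using assms by simp
      then show ?thesis
        unfolding norm_divide norm_mult norm_power by (simp add: divide_simps)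
    qed
    ultimately show ?thesis by (simp add: power2_eq_square)
  qed
  ultimately show "\<exists>D. (gg_rem has_field_derivative D) (at w) \<and> norm D \<le> 63" by blast
qed

text \<open>On the unit disc the bounds come from compactness and the holomorphic extension,
  elsewhere from the estimates far from 0. The derivative bound becomes a Lipschitz bound because
  the sector is convex.\<close>

lemma gg_rem_bounds:
  obtains C where "C > 0" "\<And>w. w \<in> sector \<Longrightarrow> norm (gg_rem w) \<le> C"
    "\<And>w. w \<in> sector \<Longrightarrow> norm (gg_rem w) \<le> C / norm w"
    "\<And>v w. v \<in> sector \<Longrightarrow> w \<in> sector \<Longrightarrow> norm (gg_rem v - gg_rem w) \<le> C * norm (v - w)"
proof -
  obtain g where g: "g holomorphic_on ball 0 (3 / 2)" "\<And>w. w \<in> ball 0 (3 / 2) - {0} \<Longrightarrow> g w = gg_rem w"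
    using gg_rem_extend by blast
  have sub: "cball 0 1 \<subseteq> ball (0 :: complex) (3 / 2)" by auto
  have "compact (g ` cball 0 1)"
    using g(1) sub by (intro compact_continuous_image holomorphic_on_imp_continuous_on) (auto intro: holomorphic_on_subset)
  then obtain C1 where C1: "\<And>w. norm w \<le> 1 \<Longrightarrow> norm (g w) \<le> C1"
    using compact_imp_bounded bounded_iff by (metis (no_types, lifting) imageI mem_cball_0)
  have "deriv g holomorphic_on ball 0 (3 / 2)" using g(1) by (intro holomorphic_deriv) auto
  then have "compact (deriv g ` cball 0 1)"
    using sub by (intro compact_continuous_image holomorphic_on_imp_continuous_on) (auto intro: holomorphic_on_subset)
  then obtain C2 where C2: "\<And>w. norm w \<le> 1 \<Longrightarrow> norm (deriv g w) \<le> C2"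
    using compact_imp_bounded bounded_iff by (metis (no_types, lifting) imageI mem_cball_0)
  define C where "C = max 63 (max C1 C2)"
  have C: "C \<ge> 63" "C \<ge> C1" "C \<ge> C2" by (auto simp: C_def)
  have 1: "norm (gg_rem w) \<le> C" and 2: "norm (gg_rem w) \<le> C / norm w" if w: "w \<in> sector" for w
  proof -
    have w0: "w \<noteq> 0" using w by (auto simp: sector_def)
    have "norm (gg_rem w) \<le> C \<and> norm (gg_rem w) \<le> C / norm w"
    proof (cases "norm w \<le> 1")
      case True
      then have "norm (gg_rem w) \<le> C1" using C1[of w] g(2)[of w] w0 by auto
      moreover have "C \<le> C / norm w" using True w0 C by (simp add: field_simps)
      ultimately show ?thesis using C by linarith
    next
      case False
      then have "norm (gg_rem w) \<le> 13 / norm w" by (intro gg_rem_far w) auto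
      moreover have "13 / norm w \<le> C / norm w" using C by (intro divide_right_mono) auto
      moreover have "13 / norm w \<le> 13 / 1" using False by (intro divide_left_mono) auto
      ultimately show ?thesis using C by linarith
    qed
    then show "norm (gg_rem w) \<le> C" "norm (gg_rem w) \<le> C / norm w" by auto
  qed
  have "\<exists>D. (gg_rem has_field_derivative D) (at w) \<and> norm D \<le> C" if w: "w \<in> sector" for w
  proof (cases "norm w < 1")
    case True
    have "(g has_field_derivative deriv g w) (at w)"
      using True by (intro holomorphic_derivI[OF g(1)]) auto
    moreover have "w \<in> ball 0 (3 / 2) - {0}" using True w by (auto simp: sector_def)
    then have "(g has_field_derivative deriv g w) (at w) \<longleftrightarrow> (gg_rem has_field_derivative deriv g w) (at w)"
      by (intro DERIV_cong_ev refl eventually_mono[OF eventually_nhds_in_open[of "ball 0 (3 / 2) - {0}"]] g(2)) auto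
    ultimately show ?thesis using C2[of w] C True by force
  next
    case False
    then show ?thesis using gg_rem_far(2)[OF w] C by force
  qed
  then obtain D where "\<And>w. w \<in> sector \<Longrightarrow> (gg_rem has_field_derivative D w) (at w)"
      "\<And>w. w \<in> sector \<Longrightarrow> norm (D w) \<le> C" by metis
  then have "norm (gg_rem v - gg_rem w) \<le> C * norm (v - w)" if "v \<in> sector" "w \<in> sector" for v w
    using that by (intro field_differentiable_bound[OF convex_sector]) (auto intro: has_field_derivative_at_within)
  then show ?thesis using 1 2 C by (intro that[of C]) auto
qed

section \<open>The alternating series for log P and its limit\<close>

lemma sums_alternating_pairs:
  fixes c :: "nat \<Rightarrow> 'a :: real_normed_field"
  assumes "c sums s" "(\<lambda>j. c (2 * j + 1)) sums t"
  shows "(\<lambda>j. c (2 * j) - c (2 * j + 1)) sums (s - 2 * t)"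
proof -
  have "(\<lambda>n. sum c {n * 2..<n * 2 + 2}) sums s" by (rule sums_group[OF assms(1)]) simp
  then have "(\<lambda>j. c (2 * j) + c (2 * j + 1)) sums s"
    by (simp add: numeral_2_eq_2 mult.commute)
  from sums_diff[OF this sums_mult[OF assms(2), of 2]] show ?thesis by simp
qed

text \<open>Two consecutive terms are joined because a single one tends to a multiple of 1/m as z
  tends to 0, so no summable bound for single terms is uniform in z.\<close>

definition gg_pair :: "nat \<Rightarrow> complex \<Rightarrow> complex" where
  "gg_pair j z = gg_rem (of_nat (2 * j + 1) * z) / of_nat (2 * j + 1) -
     gg_rem (of_nat (2 * j + 2) * z) / of_nat (2 * j + 2)"

text \<open>Replacing \<open>gg_aux\<close> by its polar part turns the alternating series into 3 /
  (4 z) times the alternating sum of 1 / m^2, that is 3 / (4 z) * pi^2 / 12; subtracting this leaves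
  the pairs.\<close>

lemma gg_log_sums:
  assumes "Re z > 0"
  shows "(\<lambda>j. gg_pair j z) sums (gg_log (exp (- z)) - of_real (pi\<^sup>2) / (16 * z))"
proof -
  \<comment> \<open>\<open>c m\<close> has multiplier m + 1, so the terms that change sign are those
    of odd index.\<close>
  define c where "c m = gg_aux (of_nat (Suc m) * z) / of_nat (Suc m)" for m
  define r where "r = exp (- Re z)"
  have r: "0 < r" "r < 1" using assms by (auto simp: r_def)
  have z: "z \<noteq> 0" using assms by auto
  have "norm (exp (- z)) < 1" using assms by simp
  note summable_norm_cancel[OF summable_gg_log[OF this]]
  then have "(\<lambda>m. gg_series (exp (- z) ^ Suc m) / of_nat (Suc m)) sums gg_log (exp (- z))"
    by (simp only: gg_log_def summable_sums)
  also have "(\<lambda>m. gg_series (exp (- z) ^ Suc m) / of_nat (Suc m)) = (\<lambda>m. c m - 2 * c (2 * m + 1))"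
  proof
    fix m
    have "exp (- z) ^ Suc m = exp (- (of_nat (Suc m) * z))"
      by (simp only: exp_of_nat_mult[symmetric] mult_minus_right)
    moreover have "Re (of_nat (Suc m) * z) > 0" using assms by simp
    ultimately have "gg_series (exp (- z) ^ Suc m) = gg_aux (of_nat (Suc m) * z) - gg_aux (2 * (of_nat (Suc m) * z))"
      by (simp only: gg_series_exp)
    moreover have "2 * (of_nat (Suc m) * z) = of_nat (Suc (2 * m + 1)) * z"
      by (simp add: algebra_simps)
    moreover have "gg_aux w / of_nat (Suc m) = 2 * (gg_aux w / of_nat (Suc (2 * m + 1)))" for w
    proof -
      have "(of_nat (Suc (2 * m + 1)) :: complex) = 2 * of_nat (Suc m)" by simp
      then show ?thesis by (simp del: of_nat_Suc)
    qed
    ultimately show "gg_series (exp (- z) ^ Suc m) / of_nat (Suc m) = c m - 2 * c (2 * m + 1)"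
      by (simp only: c_def diff_divide_distrib)
  qed
  finally have sums: "(\<lambda>m. c m - 2 * c (2 * m + 1)) sums gg_log (exp (- z))" .
  have "summable c"
  proof (rule summable_comparison_test'[where N = 0])
    show "summable (\<lambda>m. 3 / (1 - r) * r ^ m)" using r by (intro summable_mult summable_geometric) auto
    fix m :: nat
    define q where "q = exp (- (of_nat (Suc m) * z))"
    have e: "exp (- (of_nat k * (of_nat (Suc m) * z))) = q ^ k" for k
      by (simp only: q_def exp_of_nat_mult[symmetric] mult_minus_right)
    have nq: "norm q = r ^ Suc m"
      by (simp only: q_def r_def norm_exp_eq_Re exp_of_nat_mult[symmetric]) (simp add: algebra_simps)
    have q1: "norm q \<le> r" "norm q \<le> r ^ m" using r by (auto simp: nq mult_left_le power_le_one mult_left_le_one_le)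
    have qk: "norm (q ^ k) \<le> norm q" if "k > 0" for k
      unfolding norm_power using q1 r that by (intro power_decreasing[of 1 k "norm q", simplified]) auto
    have d: "norm (1 - q ^ 4) \<ge> 1 - r"
      using norm_triangle_ineq2[of 1 "q ^ 4"] qk[of 4] q1 by simp
    have N: "norm (q + q ^ 2 + q ^ 4) \<le> 3 * norm q"
      using norm_triangle_ineq[of "q + q ^ 2" "q ^ 4"] norm_triangle_ineq[of q "q ^ 2"] qk[of 2] qk[of 4] by linarith
    have "gg_aux (of_nat (Suc m) * z) = (q + q ^ 2 + q ^ 4) / (1 - q ^ 4)"
      using e[of 2] e[of 4] unfolding gg_aux_def by (simp only: q_def of_nat_numeral mult_minus_left)
    then have "norm (gg_aux (of_nat (Suc m) * z)) = norm (q + q ^ 2 + q ^ 4) / norm (1 - q ^ 4)"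
      by (simp add: norm_divide)
    also have "\<dots> \<le> (3 * r ^ m) / (1 - r)"
      using N d q1 r by (intro frac_le) auto
    finally have "norm (gg_aux (of_nat (Suc m) * z)) \<le> 3 / (1 - r) * r ^ m" by simp
    moreover have "norm (c m) \<le> norm (gg_aux (of_nat (Suc m) * z)) / 1"
      unfolding c_def norm_divide norm_of_nat by (intro divide_left_mono) auto
    ultimately show "norm (c m) \<le> 3 / (1 - r) * r ^ m" by simp
  qed
  then have c: "c sums suminf c" by (rule summable_sums)
  have "(\<lambda>m. (c m - (c m - 2 * c (2 * m + 1))) / 2) sums ((suminf c - gg_log (exp (- z))) / 2)"
    by (intro sums_divide sums_diff c sums)
  then have "(\<lambda>m. c (2 * m + 1)) sums ((suminf c - gg_log (exp (- z))) / 2)" by simp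
  from sums_alternating_pairs[OF c this]
  have 1: "(\<lambda>j. c (2 * j) - c (2 * j + 1)) sums gg_log (exp (- z))"
    by (simp only: nonzero_mult_div_cancel_left times_divide_eq_right zero_neq_numeral[symmetric] not_False_eq_True
        diff_diff_eq2 add_diff_cancel_left')
  define e :: "nat \<Rightarrow> real" where "e m = 1 / (real m + 1)\<^sup>2" for m
  have e: "e sums (pi\<^sup>2 / 6)" using inverse_squares_sums by (simp add: e_def[abs_def] add.commute)
  have "e (2 * j + 1) = e j / 4" for j by (simp add: e_def field_simps power2_eq_square)
  then have "(\<lambda>j. e (2 * j + 1)) sums (pi\<^sup>2 / 6 / 4)" using sums_divide[OF e, of 4] by (simp only:)
  from sums_alternating_pairs[OF e this]
  have "(\<lambda>j. e (2 * j) - e (2 * j + 1)) sums (pi\<^sup>2 / 12)" by simp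
  from sums_mult[OF sums_of_real[OF this], of "3 / (4 * z)"]
  have 2: "(\<lambda>j. 3 / (4 * z) * of_real (e (2 * j) - e (2 * j + 1))) sums (of_real (pi\<^sup>2) / (16 * z))"
    by simp
  have "c (2 * j) - c (2 * j + 1) - 3 / (4 * z) * of_real (e (2 * j) - e (2 * j + 1)) = gg_pair j z" for j
  proof -
    have "c m - 3 / (4 * z) * of_real (e m) = gg_rem (of_nat (Suc m) * z) / of_nat (Suc m)" for m
    proof -
      have "(of_real (e m) :: complex) = 1 / of_nat (Suc m) ^ 2"
        by (simp add: e_def add.commute)
      then show ?thesis
        unfolding c_def gg_rem_def using z
        by (simp add: diff_divide_distrib power2_eq_square del: of_nat_Suc)
    qed
    note this[of "2 * j"] this[of "2 * j + 1"]
    then show ?thesis by (simp add: gg_pair_def algebra_simps)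
  qed
  with sums_diff[OF 1 2] show ?thesis by simp
qed

text \<open>Tannery's theorem for the pairs: each tends to - 1/4 times a pair of the alternating
  harmonic series, whose sum is ln 2.\<close>

lemma tendsto_gg_log:
  "((\<lambda>z. gg_log (exp (- z)) - of_real (pi\<^sup>2) / (16 * z)) \<longlongrightarrow> - of_real (ln 2 / 4)) (at 0 within sector)"
proof -
  obtain C where C: "C > 0" "\<And>w. w \<in> sector \<Longrightarrow> norm (gg_rem w) \<le> C"
    "\<And>w. w \<in> sector \<Longrightarrow> norm (gg_rem w) \<le> C / norm w"
    "\<And>v w. v \<in> sector \<Longrightarrow> w \<in> sector \<Longrightarrow> norm (gg_rem v - gg_rem w) \<le> C * norm (v - w)"
    using gg_rem_bounds by blast
  let ?h = "\<lambda>j. inverse (real (2 * j + 1)) - inverse (real (2 * j + 2))"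
  have bound: "norm (gg_pair j z) \<le> 3 * C * real (Suc j) powr (- 3 / 2)" if z: "z \<in> sector" for j z
  proof -
    let ?v = "of_nat (2 * j + 1) * z" and ?w = "of_nat (2 * j + 2) * z"
    have z0: "norm z > 0" using z by (auto simp: sector_def)
    have v: "?v \<in> sector" and w: "?w \<in> sector"
      using scale_sector[OF z, of "real (2 * j + 1)"] scale_sector[OF z, of "real (2 * j + 2)"] by auto
    \<comment> \<open>The geometric mean of the Lipschitz bound \<open>a1\<close> and the decay bound \<open>a2\<close> does not depend on \<open>z\<close>.\<close>
    define a where "a = norm (gg_rem ?v - gg_rem ?w)"
    have "a \<le> C * norm (?v - ?w)" unfolding a_def by (rule C(4)[OF v w])
    also have "?v - ?w = - z" by (simp add: algebra_simps)
    finally have a1: "a \<le> C * norm z" by simp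
    have "a \<le> norm (gg_rem ?v) + norm (gg_rem ?w)" unfolding a_def by (rule norm_triangle_ineq4)
    also have "\<dots> \<le> C / norm ?v + C / norm ?w" by (intro add_mono C v w)
    also have "\<dots> \<le> C / (real (Suc j) * norm z) + C / (real (Suc j) * norm z)"
      unfolding norm_mult norm_of_nat using C(1) z0
      by (intro add_mono divide_left_mono mult_right_mono mult_pos_pos) auto
    finally have a2: "a \<le> 2 * C / (real (Suc j) * norm z)" by (simp add: field_simps)
    have "a * a \<le> (C * norm z) * (2 * C / (real (Suc j) * norm z))"
      using a1 a2 by (intro mult_mono) (auto simp: a_def C(1) less_imp_le)
    also have "\<dots> = 2 * C\<^sup>2 / real (Suc j)" using z0 by (simp add: power2_eq_square del: of_nat_Suc)
    also have "\<dots> \<le> (2 * C)\<^sup>2 / real (Suc j)" by (intro divide_right_mono) (auto simp: power2_eq_square)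
    also have "\<dots> = (2 * C * real (Suc j) powr (- 1 / 2))\<^sup>2"
    proof -
      have "(real (Suc j) powr (- 1 / 2))\<^sup>2 = real (Suc j) powr (- 1)"
        by (simp only: power2_eq_square powr_add[symmetric]) simp
      also have "\<dots> = 1 / real (Suc j)" by (simp add: powr_minus_divide)
      finally show ?thesis by (simp only: power_mult_distrib times_divide_eq_right mult_1_right)
    qed
    finally have "a\<^sup>2 \<le> (2 * C * real (Suc j) powr (- 1 / 2))\<^sup>2" by (simp add: power2_eq_square)
    then have a: "a \<le> 2 * C * real (Suc j) powr (- 1 / 2)"
      by (rule power2_le_imp_le) (use C(1) in auto)
    \<comment> \<open>Summation by parts within the pair: the difference of reciprocals only needs
      boundedness of \<open>gg_rem\<close>, while the difference of remainders is controlled by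
      \<open>a\<close>.\<close>
    have eq: "gg_pair j z = gg_rem ?v * of_real (?h j) + (gg_rem ?v - gg_rem ?w) * of_real (inverse (real (2 * j + 2)))"
      unfolding gg_pair_def by (simp add: divide_inverse algebra_simps)
    have h: "?h j \<ge> 0" "?h j \<le> real (Suc j) powr (- 3 / 2)"
    proof -
      have "?h j = 1 / (real (2 * j + 1) * real (2 * j + 2))" by (simp add: field_simps)
      also have "\<dots> \<le> 1 / (real (Suc j) * real (Suc j))"
        by (intro divide_left_mono mult_mono mult_pos_pos) auto
      also have "\<dots> = real (Suc j) powr (- 2)"
        by (simp add: powr_minus powr_numeral power2_eq_square inverse_eq_divide)
      also have "\<dots> \<le> real (Suc j) powr (- 3 / 2)" by (intro powr_mono) auto
      finally show "?h j \<le> real (Suc j) powr (- 3 / 2)" .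
    qed (simp add: field_simps)
    have "norm (gg_pair j z) \<le> norm (gg_rem ?v) * ?h j + a * inverse (real (2 * j + 2))"
      unfolding eq a_def using h(1)
      by (intro order_trans[OF norm_triangle_ineq] add_mono) (simp_all only: norm_mult norm_of_real abs_of_nonneg, simp_all)
    also have "\<dots> \<le> C * real (Suc j) powr (- 3 / 2) +
        (2 * C * real (Suc j) powr (- 1 / 2)) * real (Suc j) powr (- 1)"
    proof (intro add_mono mult_mono C v h a)
      show "inverse (real (2 * j + 2)) \<le> real (Suc j) powr (- 1)"
        by (simp add: powr_minus field_simps)
    qed (use C(1) h in \<open>auto simp: a_def\<close>)
    also have "\<dots> = 3 * C * real (Suc j) powr (- 3 / 2)"
    proof -
      have "real (Suc j) powr (- 1 / 2) * real (Suc j) powr (- 1) = real (Suc j) powr (- 3 / 2)"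
        by (simp only: powr_add[symmetric]) simp
      then show ?thesis by (simp only: mult.assoc)
    qed
    finally show ?thesis .
  qed
  have ev: "\<forall>\<^sub>F z in at 0 within sector. z \<in> sector" by (simp add: eventually_at_filter)
  have "((\<lambda>z. \<Sum>j. gg_pair j z) \<longlongrightarrow> (\<Sum>j. - 1 / 4 * of_real (?h j))) (at 0 within sector)"
  proof (rule tannerys_theorem[THEN conjunct2, THEN conjunct2])
    fix j
    have rem: "((\<lambda>z. gg_rem (of_nat k * z)) \<longlongrightarrow> - 1 / 4) (at 0 within sector)" if "k > 0" for k
    proof (rule filterlim_compose[OF tendsto_gg_rem])
      have "((\<lambda>z. of_nat k * z) \<longlongrightarrow> of_nat k * 0) (at 0 within sector)"
        by (intro tendsto_intros)
      moreover have "\<forall>\<^sub>F z in at 0 within sector. of_nat k * z \<noteq> (0 :: complex)"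
        unfolding eventually_at_filter using that by (intro always_eventually) auto
      ultimately show "filterlim (\<lambda>z. of_nat k * z) (at (0 :: complex)) (at 0 within sector)"
        by (simp add: filterlim_at)
    qed
    have ne: "(of_nat (2 * j + 1) :: complex) \<noteq> 0" "(of_nat (2 * j + 2) :: complex) \<noteq> 0"
      unfolding of_nat_eq_0_iff by auto
    have "((\<lambda>z. gg_pair j z) \<longlongrightarrow>
        (- 1 / 4) / of_nat (2 * j + 1) - (- 1 / 4) / of_nat (2 * j + 2)) (at 0 within sector)"
      unfolding gg_pair_def by (intro tendsto_diff tendsto_divide tendsto_const rem ne) auto
    also have "(- 1 / 4) / of_nat (2 * j + 1) - (- 1 / 4) / of_nat (2 * j + 2) =
        - 1 / 4 * complex_of_real (?h j)"
      by (simp only: of_real_diff of_real_inverse of_real_of_nat_eq divide_inverse right_diff_distrib)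
    finally show "((\<lambda>z. gg_pair j z) \<longlongrightarrow> - 1 / 4 * of_real (?h j)) (at 0 within sector)" .
  next
    show "\<forall>\<^sub>F (j, z) in sequentially \<times>\<^sub>F (at 0 within sector).
        norm (gg_pair j z) \<le> 3 * C * real (Suc j) powr (- 3 / 2)"
      using eventually_prodI[OF eventually_True ev] by (rule eventually_mono) (use bound in auto)
    have "summable (\<lambda>j. real j powr (- 3 / 2))" by (simp add: summable_real_powr_iff)
    then show "summable (\<lambda>j. 3 * C * real (Suc j) powr (- 3 / 2))"
      by (subst (asm) summable_Suc_iff[symmetric]) (rule summable_mult)
  qed (rule at_within_sector_neq_bot)
  also have "(\<Sum>j. - 1 / 4 * complex_of_real (?h j)) = - of_real (ln 2 / 4)"
  proof (rule sums_unique[symmetric])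
    show "(\<lambda>j. - 1 / 4 * complex_of_real (?h j)) sums (- of_real (ln 2 / 4))"
      using sums_mult[OF sums_of_real[OF alternating_harmonic_series_sums'], of "- 1 / 4 :: complex"] by simp
  qed
  finally show ?thesis
  proof (rule Lim_transform_eventually)
    show "\<forall>\<^sub>F z in at 0 within sector.
        (\<Sum>j. gg_pair j z) = gg_log (exp (- z)) - of_real (pi\<^sup>2) / (16 * z)"
      using ev by eventually_elim (use gg_log_sums in \<open>auto simp: sector_def sums_iff\<close>)
  qed
qed

section \<open>Minor arcs\<close>

text \<open>For \<theta> off the major arc, the real part of q / (1 - q^4) stays below 49/50 of its
  value at \<theta> = 0. Either sin (2 \<theta>) is large enough compared with \<open>E\<close> to
  enlarge the denominator, or q is close to one of the poles -1, i, -i, where cos \<theta> is small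
  or negative; the pole 1 is kept away by x \<le> |\<theta>|.\<close>

lemma trig_gap_inequality:
  fixes E \<rho> \<theta> x :: real
  assumes "0 < x" "\<rho> = 1 - E" "0 < E" "E \<le> 4 * x" "9 / 10 \<le> \<rho>"
    and sin: "x / 2 \<le> sin x" and \<theta>: "x \<le> \<bar>\<theta>\<bar>" "\<bar>\<theta>\<bar> \<le> pi"
  shows "E * (E * cos \<theta> + 2 * \<rho> * sin (2 * \<theta>) * sin \<theta>) \<le>
    49 / 50 * (E\<^sup>2 + 4 * \<rho> * (sin (2 * \<theta>))\<^sup>2)"
proof -
  define T where "T = 2 * \<rho> * \<bar>sin (2 * \<theta>)\<bar>"
  define s where "s = \<bar>sin \<theta>\<bar>"
  have T: "T \<ge> 0" using assms by (simp add: T_def)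
  have s: "0 \<le> s" "s \<le> 1" by (auto simp: s_def)
  have cs: "(cos \<theta>)\<^sup>2 + s\<^sup>2 = 1" by (simp add: s_def)
  have "T\<^sup>2 = 4 * (\<rho> * \<rho>) * (sin (2 * \<theta>))\<^sup>2" by (simp add: T_def power2_eq_square)
  also have "\<dots> \<le> 4 * (\<rho> * 1) * (sin (2 * \<theta>))\<^sup>2"
    using assms by (intro mult_right_mono mult_left_mono) auto
  finally have T2: "T\<^sup>2 \<le> 4 * \<rho> * (sin (2 * \<theta>))\<^sup>2" by simp
  have "2 * \<rho> * sin (2 * \<theta>) * sin \<theta> \<le> \<bar>2 * \<rho> * sin (2 * \<theta>) * sin \<theta>\<bar>" by (rule abs_ge_self)
  also have "\<dots> = T * s" using assms by (simp add: T_def s_def abs_mult)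
  finally have "E * (E * cos \<theta> + 2 * \<rho> * sin (2 * \<theta>) * sin \<theta>) \<le> E * (E * cos \<theta> + T * s)"
    using assms by (intro mult_left_mono) auto
  also have "\<dots> \<le> 49 / 50 * (E\<^sup>2 + T\<^sup>2)"
  proof (cases "E / 4 \<le> T")
    case True
    \<comment> \<open>With V = E cos \<theta> + T s: 2 E V \<le> E^2 + V^2, and V^2 \<le> E^2 + T^2
      by Cauchy-Schwarz. This saves half of T^2, which E \<le> 4 T converts into a fixed
      proportion.\<close>
    have "0 \<le> (E - (E * cos \<theta> + T * s))\<^sup>2" by simp
    then have "2 * (E * (E * cos \<theta> + T * s)) \<le> E\<^sup>2 + (E * cos \<theta> + T * s)\<^sup>2"
      by (simp add: power2_eq_square algebra_simps)
    also have "(E * cos \<theta> + T * s)\<^sup>2 \<le> (E * cos \<theta> + T * s)\<^sup>2 + (E * s - T * cos \<theta>)\<^sup>2" by simp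
    also have "\<dots> = (E\<^sup>2 + T\<^sup>2) * ((cos \<theta>)\<^sup>2 + s\<^sup>2)"
      by (simp add: power2_eq_square algebra_simps)
    also have "\<dots> = E\<^sup>2 + T\<^sup>2" by (simp add: cs)
    finally have "2 * (E * (E * cos \<theta> + T * s)) \<le> 2 * E\<^sup>2 + T\<^sup>2" by simp
    moreover have "(E / 4)\<^sup>2 \<le> T\<^sup>2" using True assms by (intro power_mono) auto
    then have "E\<^sup>2 \<le> 16 * T\<^sup>2" by (simp add: power2_eq_square)
    moreover have "E\<^sup>2 \<ge> 0" by simp
    ultimately show ?thesis by (simp only: ring_distribs)
  next
    case False
    \<comment> \<open>Otherwise \<theta> is near 0, where |sin \<theta>| \<ge> x / 2 forces T \<ge>
      1.26 x, more than E / 4 \<le> x.\<close>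
    have "cos \<theta> \<le> 7 / 10"
    proof (rule ccontr)
      assume c: "\<not> cos \<theta> \<le> 7 / 10"
      have "\<bar>\<theta>\<bar> \<le> pi / 2"
      proof (rule ccontr)
        assume "\<not> \<bar>\<theta>\<bar> \<le> pi / 2"
        then have "cos \<bar>\<theta>\<bar> \<le> cos (pi / 2)" using \<theta> by (intro cos_monotone_0_pi_le) auto
        then show False using c by simp
      qed
      then have "sin x \<le> sin \<bar>\<theta>\<bar>" using \<theta> assms(1) by (intro sin_monotone_2pi_le) auto
      also have "sin \<bar>\<theta>\<bar> \<le> s" by (auto simp: s_def abs_if)
      finally have "x / 2 \<le> s" using sin by simp
      moreover have "T = 4 * \<rho> * s * cos \<theta>"
        using c by (simp add: T_def s_def sin_double abs_mult)
      moreover have "4 * \<rho> * s * cos \<theta> \<ge> 4 * (9 / 10) * (x / 2) * (7 / 10)"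
        using assms c calculation(1) by (intro mult_mono) auto
      ultimately show False using False assms(1,4) by linarith
    qed
    moreover have "T * s \<le> E / 4 * 1" using False s T by (intro mult_mono) auto
    ultimately have "E * (E * cos \<theta> + T * s) \<le> E * (E * (7 / 10) + E / 4)"
      using assms(3) by (intro mult_left_mono add_mono) auto
    also have "\<dots> \<le> 49 / 50 * (E\<^sup>2 + T\<^sup>2)"
      using zero_le_power2[of E] zero_le_power2[of T] by (simp add: power2_eq_square algebra_simps)
    finally show ?thesis .
  qed
  also have "\<dots> \<le> 49 / 50 * (E\<^sup>2 + 4 * \<rho> * (sin (2 * \<theta>))\<^sup>2)" using T2 by simp
  finally show ?thesis .
qed

text \<open>Written so that sin (2 \<theta>) measures the distance to the fourth roots of unity:
  when it vanishes, only the factor cos \<theta> distinguishes the value from exp (- x) / (1 -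
  \<rho>).\<close>

lemma Re_progr_1_4:
  fixes x \<theta> :: real
  defines "q \<equiv> exp (- Complex x \<theta>)" and "\<rho> \<equiv> exp (- 4 * x)"
  shows "Re (q / (1 - q ^ 4)) = exp (- x) * ((1 - \<rho>) * cos \<theta> + 2 * \<rho> * sin (2 * \<theta>) * sin \<theta>) /
    ((1 - \<rho>)\<^sup>2 + 4 * \<rho> * (sin (2 * \<theta>))\<^sup>2)"
proof -
  have q4: "q ^ 4 = exp (- Complex (4 * x) (4 * \<theta>))"
  proof -
    have "q ^ 4 = exp (of_nat 4 * (- Complex x \<theta>))" unfolding q_def by (rule exp_of_nat_mult[symmetric])
    also have "of_nat 4 * (- Complex x \<theta>) = - Complex (4 * x) (4 * \<theta>)" by (simp add: complex_eq_iff)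
    finally show ?thesis .
  qed
  have c3: "cos \<theta> * cos (4 * \<theta>) + sin \<theta> * sin (4 * \<theta>) = cos (3 * \<theta>)"
    using cos_diff[of "4 * \<theta>" \<theta>] by (simp add: mult.commute)
  have "cos \<theta> - cos (3 * \<theta>) = cos (2 * \<theta> - \<theta>) - cos (2 * \<theta> + \<theta>)" by simp
  also have "\<dots> = 2 * sin (2 * \<theta>) * sin \<theta>" unfolding cos_diff cos_add by simp
  finally have c13: "cos (3 * \<theta>) = cos \<theta> - 2 * sin (2 * \<theta>) * sin \<theta>" by simp
  have c4: "cos (4 * \<theta>) = 1 - 2 * (sin (2 * \<theta>))\<^sup>2" using cos_double_sin[of "2 * \<theta>"] by simp
  have q: "Re q = exp (- x) * cos \<theta>" "Im q = - (exp (- x) * sin \<theta>)"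
    by (simp_all add: q_def Re_exp Im_exp)
  have d: "Re (1 - q ^ 4) = 1 - \<rho> * cos (4 * \<theta>)" "Im (1 - q ^ 4) = \<rho> * sin (4 * \<theta>)"
    unfolding q4 by (simp_all add: \<rho>_def Re_exp Im_exp)
  have "Re q * Re (1 - q ^ 4) + Im q * Im (1 - q ^ 4) =
      exp (- x) * (cos \<theta> - \<rho> * (cos \<theta> * cos (4 * \<theta>) + sin \<theta> * sin (4 * \<theta>)))"
    unfolding q d by (simp add: algebra_simps)
  also have "\<dots> = exp (- x) * ((1 - \<rho>) * cos \<theta> + 2 * \<rho> * sin (2 * \<theta>) * sin \<theta>)"
    unfolding c3 c13 by (simp add: algebra_simps)
  finally have num: "Re q * Re (1 - q ^ 4) + Im q * Im (1 - q ^ 4) =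
      exp (- x) * ((1 - \<rho>) * cos \<theta> + 2 * \<rho> * sin (2 * \<theta>) * sin \<theta>)" .
  have "(Re (1 - q ^ 4))\<^sup>2 + (Im (1 - q ^ 4))\<^sup>2 =
      1 - 2 * \<rho> * cos (4 * \<theta>) + \<rho>\<^sup>2 * ((sin (4 * \<theta>))\<^sup>2 + (cos (4 * \<theta>))\<^sup>2)"
    unfolding d by (simp only: power2_eq_square) (simp only: ring_distribs, simp)
  also have "\<dots> = 1 - 2 * \<rho> * cos (4 * \<theta>) + \<rho>\<^sup>2" by simp
  also have "\<dots> = (1 - \<rho>)\<^sup>2 + 4 * \<rho> * (sin (2 * \<theta>))\<^sup>2"
    unfolding c4 by (simp add: power2_eq_square algebra_simps)
  finally show ?thesis unfolding Re_divide num by simp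
qed

lemma gg_series_of_real: "gg_series (of_real t) = of_real ((t + t ^ 5 + t ^ 6) / (1 - t ^ 8))"
  by (simp add: gg_series_def)

lemma norm_div_one_minus_power_le:
  fixes y :: complex
  assumes "norm y < 1" "0 < d"
  shows "norm (w / (1 - y ^ d)) \<le> norm w / (1 - norm y ^ d)"
proof -
  have "norm y ^ d < 1" using assms by (simp add: power_less_one_iff)
  moreover have "1 - norm y ^ d \<le> norm (1 - y ^ d)"
    using norm_triangle_ineq2[of 1 "y ^ d"] by (simp add: norm_power)
  ultimately show ?thesis unfolding norm_divide by (intro divide_left_mono mult_pos_pos) auto
qed

lemma Re_gg_series_le:
  assumes "norm y < 1"
  shows "Re (gg_series y) \<le> Re (gg_series (of_real (norm y)))"
proof -
  have "norm (y + y ^ 5 + y ^ 6) \<le> norm y + norm y ^ 5 + norm y ^ 6"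
    by (intro order_trans[OF norm_triangle_ineq] add_mono) (auto simp: norm_power)
  moreover have "norm y ^ 8 < 1" using assms by (simp add: power_less_one_iff)
  ultimately have "norm (gg_series y) \<le> (norm y + norm y ^ 5 + norm y ^ 6) / (1 - norm y ^ 8)"
    unfolding gg_series_def
    by (intro order_trans[OF norm_div_one_minus_power_le[OF assms]] divide_right_mono) auto
  then show ?thesis
    unfolding gg_series_of_real Re_complex_of_real by (rule order_trans[OF complex_Re_le_cmod])
qed

text \<open>The classes 1 and 5 mod 8 merge into 1 mod 4, whose real part has a short closed
  form.\<close>

lemma gg_series_split:
  assumes "norm y < 1"
  shows "gg_series y = y / (1 - y ^ 4) + y ^ 6 / (1 - y ^ 8)"
proof -
  have "norm (y ^ 8) < 1" using assms by (simp add: norm_power power_less_one_iff)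
  then have "1 - y ^ 8 \<noteq> 0" by auto
  moreover have e: "1 - y ^ 8 = (1 - y ^ 4) * (1 + y ^ 4)" by (simp add: algebra_simps flip: power_add)
  ultimately have "y / (1 - y ^ 4) = y * (1 + y ^ 4) / (1 - y ^ 8)" by simp
  moreover have "y * (1 + y ^ 4) = y + y ^ 5" by algebra
  ultimately show ?thesis by (simp add: gg_series_def add_divide_distrib)
qed

text \<open>Only the term \<open>m = 0\<close> of the series is used for the gain, and in it only the progression \<open>1 mod 4\<close>.\<close>

lemma Re_gg_log_le:
  assumes "norm q < 1"
  defines "r \<equiv> complex_of_real (norm q)"
  shows "Re (gg_log q) \<le> Re (gg_log r) - (Re (r / (1 - r ^ 4)) - Re (q / (1 - q ^ 4)))"
proof -
  let ?a = "\<lambda>q m. Re (gg_series (q ^ Suc m) / of_nat (Suc m))"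
  let ?\<delta> = "Re (r / (1 - r ^ 4)) - Re (q / (1 - q ^ 4))"
  have r: "norm r < 1" using assms by simp
  have sums: "?a q sums Re (gg_log q)" if "norm q < 1" for q
    unfolding gg_log_def by (intro sums_Re summable_sums summable_norm_cancel[OF summable_gg_log[OF that]])
  have S: "(\<lambda>m. ?a r m - (if m = 0 then ?\<delta> else 0)) sums (Re (gg_log r) - ?\<delta>)"
    using sums_single[of 0 "\<lambda>_. ?\<delta>"] by (intro sums_diff sums r) (simp cong: if_cong)
  have le: "?a q m \<le> ?a r m - (if m = 0 then ?\<delta> else 0)" for m
  proof (cases m)
    case 0
    have "Re (q ^ 6 / (1 - q ^ 8)) \<le> norm (q ^ 6 / (1 - q ^ 8))" by (rule complex_Re_le_cmod)
    also have "\<dots> \<le> norm (q ^ 6) / (1 - norm q ^ 8)"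
      using assms by (intro norm_div_one_minus_power_le) auto
    also have "\<dots> = Re (of_real (norm (q ^ 6) / (1 - norm q ^ 8)))" by simp
    also have "of_real (norm (q ^ 6) / (1 - norm q ^ 8)) = r ^ 6 / (1 - r ^ 8)"
      by (simp add: r_def norm_power)
    finally show ?thesis
      using 0 gg_series_split[OF r] gg_series_split[OF assms(1)] by simp
  next
    case (Suc k)
    have "norm (q ^ Suc m) < 1" using assms(1) power_less_one_iff[of "norm q" "Suc m"]
      by (simp add: norm_power del: power_Suc)
    then have "Re (gg_series (q ^ Suc m)) \<le> Re (gg_series (of_real (norm (q ^ Suc m))))"
      by (rule Re_gg_series_le)
    also have "of_real (norm (q ^ Suc m)) = r ^ Suc m" by (simp only: r_def norm_power of_real_power)
    finally have "Re (gg_series (q ^ Suc m)) / real (Suc m) \<le> Re (gg_series (r ^ Suc m)) / real (Suc m)"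
      by (intro divide_right_mono) auto
    then show ?thesis using Suc by (simp only: Re_divide_of_nat nat.distinct if_False)
  qed
  show ?thesis by (rule sums_le[OF le sums[OF assms(1)] S])
qed

text \<open>The gain is 1/50 of \<open>exp (- x) / E\<close>, which is at least (9/10) / (4 x); this
  gives 9 / (2000 x), rounded down to 1 / (250 x).\<close>

lemma gg_log_minor_arc:
  obtains x0 where "0 < x0" "\<And>x \<theta>. 0 < x \<Longrightarrow> x < x0 \<Longrightarrow> x \<le> \<bar>\<theta>\<bar> \<Longrightarrow> \<bar>\<theta>\<bar> \<le> pi \<Longrightarrow>
    Re (gg_log (exp (- Complex x \<theta>))) \<le> Re (gg_log (exp (- of_real x))) - 1 / (250 * x)"
proof -
  have "\<forall>\<^sub>F x in at_right (0 :: real). x / 2 \<le> sin x \<and> 9 / 10 \<le> exp (- 4 * x) \<and> 9 / 10 \<le> exp (- x)"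
    by (intro eventually_conj) real_asymp+
  then obtain x0 :: real where x0': "x0 > 0"
      "\<forall>x>0. x < x0 \<longrightarrow> x / 2 \<le> sin x \<and> 9 / 10 \<le> exp (- 4 * x) \<and> 9 / 10 \<le> exp (- x)"
    unfolding eventually_at_right_field by (elim exE conjE)
  have x0: "x0 > 0" "x / 2 \<le> sin x \<and> 9 / 10 \<le> exp (- 4 * x) \<and> 9 / 10 \<le> exp (- x)"
    if "0 < x" "x < x0" for x
    using x0' that by blast+
  have "Re (gg_log (exp (- Complex x \<theta>))) \<le> Re (gg_log (exp (- of_real x))) - 1 / (250 * x)"
    if x: "0 < x" "x < x0" and \<theta>: "x \<le> \<bar>\<theta>\<bar>" "\<bar>\<theta>\<bar> \<le> pi" for x \<theta>
  proof -
    define q where "q = exp (- Complex x \<theta>)"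
    define \<rho> where "\<rho> = exp (- 4 * x)"
    define E where "E = 1 - \<rho>"
    define a where "a = exp (- x) / E"
    let ?D = "E\<^sup>2 + 4 * \<rho> * (sin (2 * \<theta>))\<^sup>2"
    have nq: "norm q = exp (- x)" by (simp add: q_def)
    then have r: "complex_of_real (norm q) = exp (- of_real x)" by (simp flip: exp_of_real)
    have \<rho>: "\<rho> < 1" "9 / 10 \<le> \<rho>" "\<rho> = 1 - E" using x x0(2)[of x, OF x] by (auto simp: \<rho>_def E_def)
    have E: "0 < E" "E \<le> 4 * x" using \<rho> exp_ge_add_one_self[of "- 4 * x"] by (auto simp: E_def \<rho>_def)
    have D: "?D > 0" using E \<rho> by (intro add_pos_nonneg) auto
    have "Re (q / (1 - q ^ 4)) = exp (- x) * (E * cos \<theta> + 2 * \<rho> * sin (2 * \<theta>) * sin \<theta>) / ?D"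
      unfolding q_def E_def \<rho>_def by (rule Re_progr_1_4)
    also have "\<dots> = exp (- x) / E * (E * (E * cos \<theta> + 2 * \<rho> * sin (2 * \<theta>) * sin \<theta>) / ?D)"
      using E by simp
    also have "\<dots> \<le> exp (- x) / E * (49 / 50)"
    proof (intro mult_left_mono)
      show "E * (E * cos \<theta> + 2 * \<rho> * sin (2 * \<theta>) * sin \<theta>) / ?D \<le> 49 / 50"
        unfolding pos_divide_le_eq[OF D] using x x0(2)[of x, OF x] \<theta> \<rho> E
        by (intro trig_gap_inequality[of x]) auto
    qed (use E in auto)
    finally have "Re (q / (1 - q ^ 4)) \<le> a * (49 / 50)" unfolding a_def .
    moreover have "Re (of_real (norm q) / (1 - of_real (norm q) ^ 4)) = a"
    proof -
      have "exp (- x) ^ 4 = exp (of_nat 4 * (- x))" by (rule exp_of_nat_mult[symmetric])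
      also have "\<dots> = \<rho>" by (simp add: \<rho>_def)
      finally have "a = norm q / (1 - norm q ^ 4)" unfolding nq a_def E_def by simp
      moreover have "of_real (norm q) / (1 - of_real (norm q) ^ 4) =
          complex_of_real (norm q / (1 - norm q ^ 4))" by simp
      ultimately show ?thesis by (simp only: Re_complex_of_real)
    qed
    moreover have "1 / (250 * x) \<le> a / 50"
    proof -
      define b where "b = 1 / x"
      have "(9 / 10) / (4 * x) \<le> a"
        unfolding a_def using x x0(2)[of x, OF x] E by (intro frac_le) auto
      moreover have "(9 / 10) / (4 * x) = 9 / 40 * b" "1 / (250 * x) = 1 / 250 * b"
        by (simp_all add: b_def)
      moreover have "b > 0" using x by (simp add: b_def)
      ultimately show ?thesis by linarith
    qed
    moreover have "norm q < 1" using x by (simp add: nq)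
    note Re_gg_log_le[OF this]
    ultimately show ?thesis unfolding q_def[symmetric] r[symmetric] by linarith
  qed
  with x0'(1) show ?thesis by (rule that)
qed

section \<open>The coefficient integral\<close>

definition gg_kernel :: "nat \<Rightarrow> nat \<Rightarrow> complex \<Rightarrow> complex" where
  "gg_kernel a d z = exp (- z) ^ a / (1 - exp (- z) ^ d)"

text \<open>Cauchy's integrand on |q| = exp (- x), parametrised by q = exp (- (x + i \<theta>)). The
  indicator makes it a function on the whole line, so that it can be truncated and rescaled by
  Lebesgue integration.\<close>

definition gg_integrand :: "nat \<Rightarrow> nat \<Rightarrow> nat \<Rightarrow> real \<Rightarrow> real \<Rightarrow> complex" where
  "gg_integrand a d n x \<theta> = indicator {- pi..pi} \<theta> *\<^sub>R
     (exp (of_nat n * Complex x \<theta>) * (gg_kernel a d (Complex x \<theta>) * exp (gg_log (exp (- Complex x \<theta>)))))"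

lemma integral_exp_int:
  "(\<integral>\<theta>. indicator {- pi..pi} \<theta> *\<^sub>R exp (\<i> * of_int k * of_real \<theta>) \<partial>lborel) =
    (if k = 0 then 2 * of_real pi else (0 :: complex))"
proof (cases "k = 0")
  case True
  have "(\<integral>\<theta>. indicator {- pi..pi} \<theta> *\<^sub>R (1 :: complex) \<partial>lborel) = of_real pi - of_real (- pi)"
    using has_vector_derivative_real_field[of "\<lambda>z. z" 1]
    by (intro integral_FTC_atLeastAtMost) auto
  then show ?thesis using True by simp
next
  case False
  let ?F = "\<lambda>\<theta>. exp (\<i> * of_int k * of_real \<theta>) / (\<i> * of_int k)"
  have "(\<integral>\<theta>. indicator {- pi..pi} \<theta> *\<^sub>R exp (\<i> * of_int k * of_real \<theta>) \<partial>lborel) = ?F pi - ?F (- pi)"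
  proof (rule integral_FTC_atLeastAtMost)
    fix \<theta> :: real
    have "((\<lambda>z. exp (\<i> * of_int k * z) / (\<i> * of_int k)) has_field_derivative
        exp (\<i> * of_int k * of_real \<theta>)) (at (of_real \<theta>))"
      using False by (auto intro!: derivative_eq_intros)
    then show "(?F has_vector_derivative exp (\<i> * of_int k * of_real \<theta>)) (at \<theta> within {- pi..pi})"
      by (rule has_vector_derivative_real_field)
  qed (auto intro!: continuous_intros)
  also have "exp (\<i> * of_int k * of_real pi) = exp (\<i> * of_int k * of_real (- pi))"
    unfolding exp_eq by (rule exI[of _ k]) (simp add: algebra_simps)
  finally show ?thesis using False by simp
qed

text \<open>The power series is integrated term by term: the norms of its terms are constant on the
  circle and summable, which also yields integrability of the sum. Orthogonality keeps only the term
  of index \<open>n\<close>.\<close>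

lemma gg_integrand_coeff:
  assumes x: "0 < x" and d: "0 < d"
  shows "integrable lborel (gg_integrand a d n x)"
    and "(\<integral>\<theta>. gg_integrand a d n x \<theta> \<partial>lborel) = 2 * of_real pi * of_nat (gg_sum a d n)"
proof -
  define t where "t = gg_sum a d"
  define f :: "nat \<Rightarrow> real \<Rightarrow> complex" where
    "f k \<theta> = indicator {- pi..pi} \<theta> *\<^sub>R
      (exp (of_nat n * Complex x \<theta>) * (of_nat (t k) * exp (- Complex x \<theta>) ^ k))" for k \<theta>
  define c where "c k = real (t k) * exp (real n * x - real k * x)" for k
  have feq: "f k \<theta> = of_real (c k) * (indicator {- pi..pi} \<theta> *\<^sub>R exp (\<i> * of_int (int n - int k) * of_real \<theta>))" for k \<theta>
  proof -
    have "exp (of_nat n * Complex x \<theta>) * exp (- Complex x \<theta>) ^ k =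
        exp (of_nat n * Complex x \<theta> + of_nat k * (- Complex x \<theta>))"
      by (simp only: exp_add exp_of_nat_mult)
    also have "of_nat n * Complex x \<theta> + of_nat k * (- Complex x \<theta>) =
        of_real (real n * x - real k * x) + \<i> * of_int (int n - int k) * of_real \<theta>"
      by (simp add: complex_eq_iff algebra_simps)
    finally have "exp (of_nat n * Complex x \<theta>) * exp (- Complex x \<theta>) ^ k =
        of_real (exp (real n * x - real k * x)) * exp (\<i> * of_int (int n - int k) * of_real \<theta>)"
      by (simp only: exp_add exp_of_real)
    then show ?thesis
      unfolding f_def c_def scaleR_conv_of_real of_real_mult of_real_of_nat_eq by (simp only: ac_simps)
  qed
  have int_exp: "integrable lborel (\<lambda>\<theta>. indicator {- pi..pi} \<theta> *\<^sub>R exp (\<i> * of_int k * complex_of_real \<theta>))" for k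
    by (intro borel_integrable_atLeastAtMost'[unfolded set_integrable_def] continuous_intros)
  have int: "integrable lborel (f k)" for k
    unfolding feq[abs_def] by (intro integrable_mult_right int_exp)
  have norm_f: "norm (f k \<theta>) = c k * indicator {- pi..pi} \<theta>" for k \<theta>
    unfolding feq norm_mult norm_scaleR norm_of_real by (simp add: c_def norm_exp_eq_Re)
  have sum: "(\<lambda>k. f k \<theta>) sums gg_integrand a d n x \<theta>" for \<theta>
  proof -
    have "norm (exp (- Complex x \<theta>)) < 1" using x by simp
    from sums_mult[OF gg_sum_gf_sums[OF this d], of "exp (of_nat n * Complex x \<theta>)" a]
    have "(\<lambda>k. exp (of_nat n * Complex x \<theta>) * (of_nat (t k) * exp (- Complex x \<theta>) ^ k)) sums
        (exp (of_nat n * Complex x \<theta>) * (gg_kernel a d (Complex x \<theta>) * exp (gg_log (exp (- Complex x \<theta>)))))"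
      by (simp only: t_def gg_kernel_def)
    then show ?thesis unfolding f_def gg_integrand_def by (rule sums_scaleR_right)
  qed
  have summ: "summable c"
  proof -
    have "norm (complex_of_real (exp (- x))) < 1" using x by simp
    from sums_summable[OF gg_sum_gf_sums[OF this d]]
    have "summable (\<lambda>k. complex_of_real (real (t k) * exp (- x) ^ k))"
      by (simp add: t_def)
    then have "summable (\<lambda>k. real (t k) * exp (- x) ^ k)" by (simp only: summable_complex_of_real)
    then have "summable (\<lambda>k. exp (real n * x) * (real (t k) * exp (- x) ^ k))" by (rule summable_mult)
    also have "(\<lambda>k. exp (real n * x) * (real (t k) * exp (- x) ^ k)) = c"
    proof
      fix k
      have "exp (real n * x - real k * x) = exp (real n * x) * exp (- x) ^ k"
        by (simp only: exp_of_nat_mult[symmetric] exp_add[symmetric]) simp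
      then show "exp (real n * x) * (real (t k) * exp (- x) ^ k) = c k" by (simp add: c_def)
    qed
    finally show ?thesis .
  qed
  have AE: "AE \<theta> in lborel. summable (\<lambda>k. norm (f k \<theta>))"
    unfolding norm_f by (intro AE_I2 summable_mult2 summ)
  have summ': "summable (\<lambda>k. \<integral>\<theta>. norm (f k \<theta>) \<partial>lborel)"
    unfolding norm_f by (simp add: summable_mult2 summ)
  have eq: "(\<lambda>\<theta>. \<Sum>k. f k \<theta>) = gg_integrand a d n x"
    using sum by (auto simp: sums_iff)
  show "integrable lborel (gg_integrand a d n x)"
    using integrable_suminf[OF int AE summ'] unfolding eq .
  have "(\<lambda>k. \<integral>\<theta>. f k \<theta> \<partial>lborel) sums (\<integral>\<theta>. gg_integrand a d n x \<theta> \<partial>lborel)"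
    using sums_integral[OF int AE summ'] unfolding eq .
  moreover have "(\<integral>\<theta>. f k \<theta> \<partial>lborel) = (if k = n then 2 * of_real pi * of_nat (t n) else 0)" for k
    unfolding feq[abs_def] by (simp only: integral_mult_right_zero integral_exp_int) (simp add: c_def)
  ultimately have "(\<lambda>k. if k = n then 2 * of_real pi * of_nat (t n) else 0) sums
      (\<integral>\<theta>. gg_integrand a d n x \<theta> \<partial>lborel)" by simp
  moreover have "(\<lambda>k. if k = n then 2 * of_real pi * of_nat (t n) else 0) sums
      (2 * of_real pi * of_nat (t n) :: complex)" by (rule sums_single)
  ultimately show "(\<integral>\<theta>. gg_integrand a d n x \<theta> \<partial>lborel) = 2 * of_real pi * of_nat (gg_sum a d n)"
    unfolding t_def by (rule sums_unique2)
qed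

text \<open>The residue at 0 does not depend on \<open>a\<close>, so in the limit only the
  difference of a progression counts.\<close>

lemma tendsto_gg_kernel:
  assumes "0 < d"
  shows "((\<lambda>z. z * gg_kernel a d z) \<longlongrightarrow> 1 / of_nat d) (at 0)"
proof -
  have "((\<lambda>z. - (exp (- z) ^ d)) has_field_derivative of_nat d) (at (0 :: complex))"
    by (auto intro!: derivative_eq_intros)
  then have "((\<lambda>z. (1 - exp (- z) ^ d) / z) \<longlongrightarrow> of_nat d) (at (0 :: complex))"
    by (simp add: DERIV_def)
  moreover have "((\<lambda>z :: complex. exp (- z) ^ a) \<longlongrightarrow> 1) (at 0)"
    by (auto intro!: tendsto_eq_intros)
  ultimately have "((\<lambda>z. exp (- z) ^ a / ((1 - exp (- z) ^ d) / z)) \<longlongrightarrow> 1 / of_nat d) (at (0 :: complex))"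
    using assms by (intro tendsto_divide) auto
  then show ?thesis by (simp add: gg_kernel_def mult.commute)
qed

text \<open>Valid on the whole line Re z = x, hence also near the other d-th roots of unity; there
  the loss 2 / x is outweighed by the exponential gain in P.\<close>

lemma norm_gg_kernel_le:
  assumes "0 < x" "x \<le> 1" "0 < d" "Re z = x"
  shows "norm (gg_kernel a d z) \<le> 2 / x"
proof -
  have nq: "norm (exp (- z)) = exp (- x)" using assms by simp
  have "exp (- x) ^ d \<le> exp (- x)"
    using power_decreasing[of 1 d "exp (- x)"] assms by simp
  also have "exp (- x) \<le> 1 / (1 + x)"
    using exp_ge_add_one_self[of x] assms by (simp add: exp_minus inverse_eq_divide frac_le)
  also have "\<dots> \<le> 1 - x / 2" using assms by (simp add: field_simps)
  finally have d: "x / 2 \<le> 1 - exp (- x) ^ d" by simp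
  have "norm (gg_kernel a d z) \<le> norm (exp (- z) ^ a) / (1 - norm (exp (- z)) ^ d)"
    unfolding gg_kernel_def using assms by (intro norm_div_one_minus_power_le) auto
  also have "\<dots> \<le> 1 / (x / 2)"
    unfolding norm_power nq using assms d by (intro frac_le) (auto simp: power_le_one)
  finally show ?thesis by simp
qed

text \<open>The limit - ln 2 / 4 lies below 1. The bound serves for domination on the major arc and
  at the real point with which the minor arcs are compared.\<close>

lemma gg_log_sector_bound:
  obtains \<epsilon> where "\<epsilon> > 0" "\<And>z. z \<in> sector \<Longrightarrow> norm z < \<epsilon> \<Longrightarrow>
    Re (gg_log (exp (- z)) - of_real (pi\<^sup>2) / (16 * z)) \<le> 1"
proof -
  have "((\<lambda>z. Re (gg_log (exp (- z)) - of_real (pi\<^sup>2) / (16 * z))) \<longlongrightarrow> Re (- of_real (ln 2 / 4)))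
      (at 0 within sector)"
    by (intro tendsto_Re tendsto_gg_log)
  moreover have "Re (- of_real (ln 2 / 4)) < 1"
  proof -
    have "Re (- complex_of_real (ln 2 / 4)) = - (ln 2 / 4)" "0 < ln (2 :: real)" by simp_all
    then show ?thesis by linarith
  qed
  ultimately have "\<forall>\<^sub>F z in at 0 within sector. Re (gg_log (exp (- z)) - of_real (pi\<^sup>2) / (16 * z)) < 1"
    by (rule order_tendstoD)
  then obtain \<epsilon> where "\<epsilon> > 0"
      "\<And>z. z \<in> sector \<Longrightarrow> z \<noteq> 0 \<Longrightarrow> dist z 0 < \<epsilon> \<Longrightarrow>
        Re (gg_log (exp (- z)) - of_real (pi\<^sup>2) / (16 * z)) < 1"
    unfolding eventually_at by blast
  moreover have "z \<noteq> 0" if "z \<in> sector" for z using that by (auto simp: sector_def)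
  ultimately show ?thesis by (intro that[of \<epsilon>]) (auto intro: less_imp_le)
qed

section \<open>The saddle point\<close>

text \<open>The minimum over x > 0 of n x + pi^2 / (16 x), with value pi^2 / (8 x) = (pi / 2) sqrt
  n.\<close>

definition saddle :: "nat \<Rightarrow> real" where "saddle n = pi / (4 * sqrt (real n))"

lemma saddle_pos: "0 < n \<Longrightarrow> 0 < saddle n"
  by (simp add: saddle_def)

lemma of_nat_conv_saddle: "0 < n \<Longrightarrow> real n = pi\<^sup>2 / (16 * (saddle n)\<^sup>2)"
  by (simp add: saddle_def power_divide power_mult_distrib)

lemma filterlim_saddle: "filterlim saddle (at_right 0) sequentially"
  unfolding saddle_def by real_asymp

text \<open>The choice of \<open>saddle\<close> makes the term of \<open>n z + pi\<^sup>2 / (16 z)\<close> linear in \<open>z - x\<close> vanish.\<close>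

lemma saddle_exponent:
  fixes x v :: real
  assumes "0 < x" "real n = pi\<^sup>2 / (16 * x\<^sup>2)"
  shows "of_nat n * Complex x (x * v) + of_real (pi\<^sup>2) / (16 * Complex x (x * v)) =
    of_real (pi\<^sup>2 / (8 * x)) - of_real (pi\<^sup>2 / 16 * (v\<^sup>2 / x)) / Complex 1 v"
proof -
  \<comment> \<open>For z = x w the exponent is pi^2 / (16 x) times w + 1/w = 2 + (w - 1)^2 / w,
    stationary at w = 1, and (w - 1)^2 = - v^2.\<close>
  define w where "w = Complex 1 v"
  have w0: "w \<noteq> 0" by (simp add: w_def complex_eq_iff)
  have z: "Complex x (x * v) = of_real x * w" by (simp add: w_def complex_eq_iff)
  have v: "of_real (v\<^sup>2) = - ((w - 1)\<^sup>2)" by (simp add: w_def complex_eq_iff power2_eq_square)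
  have n: "of_nat n = complex_of_real (pi\<^sup>2) / (16 * (of_real x)\<^sup>2)"
    using arg_cong[OF assms(2), of complex_of_real] by simp
  have "of_nat n * (of_real x * w) + of_real (pi\<^sup>2) / (16 * (of_real x * w)) =
      of_real (pi\<^sup>2) / (16 * of_real x) * (w + 1 / w)"
    using w0 assms(1) unfolding n by (simp add: power2_eq_square divide_simps) (simp add: algebra_simps)
  also have "w + 1 / w = 2 + (w - 1)\<^sup>2 / w"
    using w0 by (simp add: power2_eq_square divide_simps) (simp add: algebra_simps)
  also have "of_real (pi\<^sup>2) / (16 * of_real x) * (2 + (w - 1)\<^sup>2 / w) =
      of_real (pi\<^sup>2 / (8 * x)) - of_real (pi\<^sup>2 / 16 / x) * (- ((w - 1)\<^sup>2)) / w"
    using w0 by (simp add: ring_distribs)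
  also have "of_real (pi\<^sup>2 / 16 / x) * (- ((w - 1)\<^sup>2)) = complex_of_real (pi\<^sup>2 / 16 * (v\<^sup>2 / x))"
    unfolding v[symmetric] by simp
  finally show ?thesis unfolding z w_def .
qed

section \<open>The Gaussian limit on the major arc\<close>

lemma gaussian_integral:
  "integrable lborel (\<lambda>u :: real. exp (- (c * u\<^sup>2)))"
  "(\<integral>u. exp (- (c * u\<^sup>2)) \<partial>lborel) = sqrt (pi / c)" if "0 < c"
proof -
  define \<sigma> where "\<sigma> = 1 / sqrt (2 * c)"
  have \<sigma>: "\<sigma> > 0" "\<sigma>\<^sup>2 = 1 / (2 * c)" using that by (auto simp: \<sigma>_def power_divide)
  have eq: "(\<lambda>u :: real. exp (- (c * u\<^sup>2))) = (\<lambda>u. sqrt (pi / c) * normal_density 0 \<sigma> u)"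
    using that by (auto simp: normal_density_def \<sigma>)
  show "integrable lborel (\<lambda>u :: real. exp (- (c * u\<^sup>2)))"
    unfolding eq using \<sigma> by (intro integrable_mult_right) auto
  show "(\<integral>u. exp (- (c * u\<^sup>2)) \<partial>lborel) = sqrt (pi / c)"
    unfolding eq using \<sigma> by simp
qed

text \<open>The exponent falls off like pi^2 \<theta>^2 / (16 x^3), so \<theta> = x powr (3/2) * u
  is the scale of the peak. The prefactor cancels the pole of the kernel and the peak value exp
  (pi^2 / (8 x)); the indicator cuts out the major arc.\<close>

definition gg_rescaled :: "nat \<Rightarrow> nat \<Rightarrow> nat \<Rightarrow> real \<Rightarrow> complex" where
  "gg_rescaled a d n u = (let x = saddle n in of_real (x * exp (- (pi\<^sup>2 / (8 * x)))) *
     (indicator {- x..x} (x * sqrt x * u) *\<^sub>R gg_integrand a d n x (x * sqrt x * u)))"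

text \<open>An exact factorisation whose three factors have separate limits: the error in log P, the
  kernel freed of its pole, and a Gaussian disturbed by 1 / (1 + i v).\<close>

lemma gg_rescaled_eq:
  assumes n: "0 < n" and x: "x = saddle n" "x \<le> pi" and u: "\<bar>sqrt x * u\<bar> \<le> 1"
  defines "z \<equiv> Complex x (x * (sqrt x * u))"
  shows "gg_rescaled a d n u = exp (gg_log (exp (- z)) - of_real (pi\<^sup>2) / (16 * z)) *
    (of_real x * gg_kernel a d z) * exp (- of_real (pi\<^sup>2 / 16 * u\<^sup>2) / Complex 1 (sqrt x * u))"
proof -
  have x0: "0 < x" using n x by (simp add: saddle_pos)
  have le: "\<bar>x * (sqrt x * u)\<bar> \<le> x" using u x0 by (simp add: abs_mult mult_left_le)
  then have mem: "x * (sqrt x * u) \<in> {- x..x}" "x * (sqrt x * u) \<in> {- pi..pi}"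
    using x(2) by (auto simp: abs_le_iff)
  have "real n = pi\<^sup>2 / (16 * x\<^sup>2)" using n x by (simp add: of_nat_conv_saddle)
  from saddle_exponent[OF x0 this, of "sqrt x * u"]
  have e: "of_nat n * z + of_real (pi\<^sup>2) / (16 * z) =
      of_real (pi\<^sup>2 / (8 * x)) - of_real (pi\<^sup>2 / 16 * u\<^sup>2) / Complex 1 (sqrt x * u)"
    using x0 unfolding z_def by (simp add: power_mult_distrib)
  have "exp (- (of_real (pi\<^sup>2 / (8 * x)))) * (exp (of_nat n * z) * exp (gg_log (exp (- z)))) =
      exp (gg_log (exp (- z)) - of_real (pi\<^sup>2) / (16 * z) +
        (of_nat n * z + of_real (pi\<^sup>2) / (16 * z) - of_real (pi\<^sup>2 / (8 * x))))"
    by (simp only: exp_add[symmetric]) (simp add: algebra_simps)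
  also have "\<dots> = exp (gg_log (exp (- z)) - of_real (pi\<^sup>2) / (16 * z)) *
      exp (- of_real (pi\<^sup>2 / 16 * u\<^sup>2) / Complex 1 (sqrt x * u))"
    unfolding e exp_add by simp
  finally have E: "exp (- (of_real (pi\<^sup>2 / (8 * x)))) * (exp (of_nat n * z) * exp (gg_log (exp (- z)))) = \<dots>" .
  have "gg_rescaled a d n u = of_real (x * exp (- (pi\<^sup>2 / (8 * x)))) *
      (exp (of_nat n * z) * (gg_kernel a d z * exp (gg_log (exp (- z)))))"
    unfolding gg_rescaled_def gg_integrand_def Let_def x(1)[symmetric] mult.assoc z_def
    using mem by simp
  also have "\<dots> = (of_real x * gg_kernel a d z) *
      (exp (- (of_real (pi\<^sup>2 / (8 * x)))) * (exp (of_nat n * z) * exp (gg_log (exp (- z)))))"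
    unfolding of_real_mult exp_of_real[symmetric] of_real_minus by (simp only: ac_simps)
  finally show ?thesis unfolding E by (simp only: ac_simps)
qed

lemma gg_rescaled_outside:
  assumes n: "0 < n" and u: "\<not> \<bar>sqrt (saddle n) * u\<bar> \<le> 1"
  shows "gg_rescaled a d n u = 0"
proof -
  define x where "x = saddle n"
  have x0: "0 < x" using n by (simp add: x_def saddle_pos)
  have "x * 1 < x * \<bar>sqrt x * u\<bar>" using u x0 unfolding x_def[symmetric] by (intro mult_strict_left_mono) auto
  also have "\<dots> = \<bar>x * sqrt x * u\<bar>" using x0 by (simp add: abs_mult)
  finally have "x * sqrt x * u \<notin> {- x..x}" by auto
  then show ?thesis by (simp add: gg_rescaled_def Let_def flip: x_def)
qed

lemma tendsto_gg_rescaled: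
  assumes d: "0 < d"
  shows "(\<lambda>n. gg_rescaled a d n u) \<longlonglongrightarrow> of_real (2 powr (- 1 / 4) / real d * exp (- (pi\<^sup>2 / 16 * u\<^sup>2)))"
proof -
  let ?x = saddle
  let ?z = "\<lambda>n. Complex (?x n) (?x n * (sqrt (?x n) * u))"
  have x0: "?x \<longlonglongrightarrow> 0" using filterlim_saddle by (simp add: filterlim_at)
  then have v0: "(\<lambda>n. sqrt (?x n) * u) \<longlonglongrightarrow> 0" by (auto intro!: tendsto_eq_intros)
  have evn: "\<forall>\<^sub>F n in sequentially. 0 < n" by (rule eventually_gt_at_top)
  have "(\<lambda>n. \<bar>sqrt (?x n) * u\<bar>) \<longlonglongrightarrow> 0" using v0 by (rule tendsto_rabs_zero)
  then have evu: "\<forall>\<^sub>F n in sequentially. \<bar>sqrt (?x n) * u\<bar> < 1" by (rule order_tendstoD) simp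
  have evx: "\<forall>\<^sub>F n in sequentially. ?x n < pi" using x0 by (rule order_tendstoD) simp
  have evz: "\<forall>\<^sub>F n in sequentially. ?z n \<in> sector"
    using evn evu
  proof eventually_elim
    case (elim n)
    then have "0 < ?x n" by (simp add: saddle_pos)
    then show ?case using elim by (simp add: sector_def abs_mult mult_left_le)
  qed
  have z0: "?z \<longlonglongrightarrow> 0"
  proof -
    have "(\<lambda>n. of_real (?x n) + \<i> * of_real (?x n * (sqrt (?x n) * u))) \<longlonglongrightarrow> of_real 0 + \<i> * of_real (0 * 0)"
      by (intro tendsto_intros x0 v0)
    then show ?thesis unfolding Complex_eq by simp
  qed
  have z_at: "filterlim ?z (at 0 within sector) sequentially"
    unfolding filterlim_at using z0 evz by (auto simp: sector_def Complex_eq_0 elim!: eventually_mono)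
  then have z_at': "filterlim ?z (at 0) sequentially"
    by (rule filterlim_mono) (auto intro: at_le)
  have w: "(\<lambda>n. Complex 1 (sqrt (?x n) * u)) \<longlonglongrightarrow> 1"
  proof -
    have "(\<lambda>n. of_real 1 + \<i> * of_real (sqrt (?x n) * u)) \<longlonglongrightarrow> of_real 1 + \<i> * of_real 0"
      by (intro tendsto_intros v0)
    then show ?thesis unfolding Complex_eq by simp
  qed
  \<comment> \<open>The kernel's limit is known with the factor z, but the rescaled integrand has
    the factor x; they differ by \<open>Complex 1 (sqrt (?x n) * u)\<close>, which tends to
    1.\<close>
  have "(\<lambda>n. exp (gg_log (exp (- ?z n)) - of_real (pi\<^sup>2) / (16 * ?z n)) *
      (?z n * gg_kernel a d (?z n) / Complex 1 (sqrt (?x n) * u)) *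
      exp (- of_real (pi\<^sup>2 / 16 * u\<^sup>2) / Complex 1 (sqrt (?x n) * u))) \<longlonglongrightarrow>
      exp (- of_real (ln 2 / 4)) * (1 / of_nat d / 1) * exp (- of_real (pi\<^sup>2 / 16 * u\<^sup>2) / 1)"
    by (intro tendsto_mult tendsto_exp tendsto_divide tendsto_const w
        filterlim_compose[OF tendsto_gg_log z_at] filterlim_compose[OF tendsto_gg_kernel[OF d] z_at']) auto
  also have "exp (- of_real (ln 2 / 4)) * (1 / of_nat d / 1) * exp (- of_real (pi\<^sup>2 / 16 * u\<^sup>2) / 1) =
      complex_of_real (2 powr (- 1 / 4) / real d * exp (- (pi\<^sup>2 / 16 * u\<^sup>2)))"
  proof -
    have "2 powr (- 1 / 4) = exp (- (ln 2 / 4) :: real)" by (simp add: powr_def)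
    then have "complex_of_real (2 powr (- 1 / 4)) = exp (- of_real (ln 2 / 4))"
      by (simp only: exp_of_real[symmetric] of_real_minus)
    moreover have "complex_of_real (exp (- (pi\<^sup>2 / 16 * u\<^sup>2))) = exp (- of_real (pi\<^sup>2 / 16 * u\<^sup>2))"
      by (simp only: exp_of_real[symmetric] of_real_minus)
    ultimately show ?thesis
      by (simp only: of_real_mult of_real_divide of_real_of_nat_eq div_by_1 times_divide_eq_right mult_1_right)
  qed
  finally show ?thesis
  proof (rule Lim_transform_eventually)
    show "\<forall>\<^sub>F n in sequentially. exp (gg_log (exp (- ?z n)) - of_real (pi\<^sup>2) / (16 * ?z n)) *
      (?z n * gg_kernel a d (?z n) / Complex 1 (sqrt (?x n) * u)) *
      exp (- of_real (pi\<^sup>2 / 16 * u\<^sup>2) / Complex 1 (sqrt (?x n) * u)) = gg_rescaled a d n u"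
      using evn evu evx
    proof eventually_elim
      case (elim n)
      have cancel: "Z * K / W = X * K" if "Z = X * W" "W \<noteq> 0" for K W X Z :: complex
        using that by simp
      have "?z n = of_real (?x n) * Complex 1 (sqrt (?x n) * u)" by (simp add: complex_eq_iff)
      moreover have "Complex 1 (sqrt (?x n) * u) \<noteq> 0" by (simp add: complex_eq_iff)
      ultimately have "?z n * gg_kernel a d (?z n) / Complex 1 (sqrt (?x n) * u) = of_real (?x n) * gg_kernel a d (?z n)"
        by (rule cancel)
      then show ?case using gg_rescaled_eq[OF elim(1) refl, of u a d] elim by simp
    qed
  qed
qed

text \<open>One integrable majorant for all large \<open>n\<close>: 2 from the kernel, exp 1 from
  the bound in the sector, and half of the Gaussian exponent.\<close>

lemma norm_gg_rescaled_le:
  assumes d: "0 < d"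
  shows "\<forall>\<^sub>F n in sequentially. \<forall>u. norm (gg_rescaled a d n u) \<le> 2 * exp 1 * exp (- (pi\<^sup>2 / 32 * u\<^sup>2))"
proof -
  obtain \<epsilon> where \<epsilon>: "\<epsilon> > 0" "\<And>z. z \<in> sector \<Longrightarrow> norm z < \<epsilon> \<Longrightarrow>
    Re (gg_log (exp (- z)) - of_real (pi\<^sup>2) / (16 * z)) \<le> 1"
    using gg_log_sector_bound by blast
  have x0: "saddle \<longlonglongrightarrow> 0" using filterlim_saddle by (simp add: filterlim_at)
  have "\<forall>\<^sub>F n in sequentially. saddle n < min 1 (\<epsilon> / 2)"
    using x0 by (rule order_tendstoD) (use \<epsilon> in auto)
  moreover have "\<forall>\<^sub>F n in sequentially. 0 < n" by (rule eventually_gt_at_top)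
  ultimately show ?thesis
  proof eventually_elim
    case (elim n)
    show ?case
    proof
      fix u
      define x where "x = saddle n"
      define v where "v = sqrt x * u"
      have x: "0 < x" "x < 1" "x < \<epsilon> / 2" using elim by (auto simp: x_def saddle_pos)
      show "norm (gg_rescaled a d n u) \<le> 2 * exp 1 * exp (- (pi\<^sup>2 / 32 * u\<^sup>2))"
      proof (cases "\<bar>v\<bar> \<le> 1")
        case False
        then show ?thesis using gg_rescaled_outside[OF elim(2), of u a d] by (simp add: v_def x_def)
      next
        case True
        define z where "z = Complex x (x * v)"
        have zs: "z \<in> sector" using x True by (simp add: z_def sector_def abs_mult mult_left_le)
        have "norm z \<le> 2 * x" using norm_le_of_sector[OF zs] by (simp add: z_def)
        then have Re: "Re (gg_log (exp (- z)) - of_real (pi\<^sup>2) / (16 * z)) \<le> 1"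
          using x by (intro \<epsilon>(2) zs) auto
        have ker: "norm (gg_kernel a d z) \<le> 2 / x"
          using x d by (intro norm_gg_kernel_le) (auto simp: z_def)
        have "x \<le> pi" using x pi_gt3 by linarith
        then have "gg_rescaled a d n u = exp (gg_log (exp (- z)) - of_real (pi\<^sup>2) / (16 * z)) *
            (of_real x * gg_kernel a d z) * exp (- of_real (pi\<^sup>2 / 16 * u\<^sup>2) / Complex 1 v)"
          using gg_rescaled_eq[OF elim(2) x_def, of u a d] True unfolding z_def v_def by blast
        then have "norm (gg_rescaled a d n u) = exp (Re (gg_log (exp (- z)) - of_real (pi\<^sup>2) / (16 * z))) *
            (x * norm (gg_kernel a d z)) * exp (Re (- of_real (pi\<^sup>2 / 16 * u\<^sup>2) / Complex 1 v))"
          using x by (simp only: norm_mult norm_exp_eq_Re norm_of_real abs_of_pos)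
        also have "\<dots> \<le> exp 1 * (x * (2 / x)) * exp (- (pi\<^sup>2 / 32 * u\<^sup>2))"
        proof (intro mult_mono)
          \<comment> \<open>The real part of 1 / (1 + i v) is 1 / (1 + v^2) \<ge> 1/2, which turns
            pi^2 / 16 into pi^2 / 32.\<close>
          have "v\<^sup>2 \<le> 1" using True by (simp add: abs_square_le_1)
          then have "pi\<^sup>2 / 16 * u\<^sup>2 / 2 \<le> pi\<^sup>2 / 16 * u\<^sup>2 / (1 + v\<^sup>2)"
            by (intro divide_left_mono mult_pos_pos) (auto simp: add_pos_nonneg)
          moreover have "Re (- of_real (pi\<^sup>2 / 16 * u\<^sup>2) / Complex 1 v) = - (pi\<^sup>2 / 16 * u\<^sup>2 / (1 + v\<^sup>2))"
            unfolding Re_divide by (simp del: of_real_mult of_real_divide of_real_power)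
          ultimately show "exp (Re (- of_real (pi\<^sup>2 / 16 * u\<^sup>2) / Complex 1 v)) \<le> exp (- (pi\<^sup>2 / 32 * u\<^sup>2))"
            by (simp only: exp_le_cancel_iff)
        qed (use x Re ker in auto)
        also have "\<dots> = 2 * exp 1 * exp (- (pi\<^sup>2 / 32 * u\<^sup>2))" using x by simp
        finally show ?thesis .
      qed
    qed
  qed
qed

text \<open>Measurability is inherited from the integrability obtained by termwise
  integration.\<close>

lemma measurable_gg_rescaled:
  assumes "0 < d" "0 < n"
  shows "gg_rescaled a d n \<in> borel_measurable lborel"
proof -
  have [measurable]: "gg_integrand a d n (saddle n) \<in> borel_measurable borel"
    using borel_measurable_integrable[OF gg_integrand_coeff(1)[OF saddle_pos[OF assms(2)] assms(1), of a n]]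
    by simp
  show ?thesis unfolding gg_rescaled_def[abs_def] Let_def by measurable
qed

lemma tendsto_integral_gg_rescaled:
  assumes d: "0 < d"
  shows "(\<lambda>n. \<integral>u. gg_rescaled a d n u \<partial>lborel) \<longlonglongrightarrow>
    of_real (2 powr (- 1 / 4) / real d * (4 / sqrt pi))"
proof -
  obtain N where N: "\<And>n u. n \<ge> N \<Longrightarrow> norm (gg_rescaled a d n u) \<le> 2 * exp 1 * exp (- (pi\<^sup>2 / 32 * u\<^sup>2))"
    using norm_gg_rescaled_le[OF d, of a] unfolding eventually_sequentially by blast
  let ?l = "\<lambda>u. complex_of_real (2 powr (- 1 / 4) / real d * exp (- (pi\<^sup>2 / 16 * u\<^sup>2)))"
  \<comment> \<open>The majorant must hold for every index; the shift by \<open>Suc N\<close>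
    secures both \<open>n \<ge> N\<close> and \<open>n > 0\<close>.\<close>
  have lim: "(\<lambda>n. \<integral>u. gg_rescaled a d (n + Suc N) u \<partial>lborel) \<longlonglongrightarrow> (\<integral>u. ?l u \<partial>lborel)"
  proof (rule integral_dominated_convergence)
    show "?l \<in> borel_measurable lborel" by simp
    show "gg_rescaled a d (n + Suc N) \<in> borel_measurable lborel" for n
      by (intro measurable_gg_rescaled d) simp
    show "integrable lborel (\<lambda>u. 2 * exp 1 * exp (- (pi\<^sup>2 / 32 * u\<^sup>2)))"
      by (intro integrable_mult_right gaussian_integral) simp
    show "AE u in lborel. (\<lambda>n. gg_rescaled a d (n + Suc N) u) \<longlonglongrightarrow> ?l u"
      by (intro AE_I2 LIMSEQ_ignore_initial_segment tendsto_gg_rescaled d)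
    show "AE u in lborel. norm (gg_rescaled a d (n + Suc N) u) \<le> 2 * exp 1 * exp (- (pi\<^sup>2 / 32 * u\<^sup>2))" for n
      by (intro AE_I2 N) simp
  qed
  have "(\<integral>u. ?l u \<partial>lborel) = of_real (2 powr (- 1 / 4) / real d * (4 / sqrt pi))"
  proof -
    have "(\<integral>u. 2 powr (- 1 / 4) / real d * exp (- (pi\<^sup>2 / 16 * u\<^sup>2)) \<partial>lborel) =
        2 powr (- 1 / 4) / real d * sqrt (pi / (pi\<^sup>2 / 16))"
      by (subst integral_mult_right_zero) (simp only: gaussian_integral(2)[of "pi\<^sup>2 / 16"] zero_less_power pi_gt_zero divide_pos_pos zero_less_numeral)
    moreover have "sqrt (pi / (pi\<^sup>2 / 16)) = 4 / sqrt pi"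
      by (simp add: power2_eq_square real_sqrt_divide)
    ultimately show ?thesis by (simp only: integral_complex_of_real)
  qed
  then show ?thesis using LIMSEQ_offset[OF lim] by (simp only:)
qed

text \<open>Only absolute values are used: exp (n x) = exp (pi^2 / (16 x)), at most 2 / x for the
  kernel, at most exp (1 + pi^2 / (16 x) - 1 / (250 x)) for P, and total length at most 2 pi. The
  two equal exponents add up to pi^2 / (8 x).\<close>

lemma minor_arc_bound:
  assumes d: "0 < d"
  shows "\<forall>\<^sub>F n in sequentially.
    norm (\<integral>\<theta>. indicator (- {- saddle n..saddle n}) \<theta> *\<^sub>R gg_integrand a d n (saddle n) \<theta> \<partial>lborel) \<le>
    4 * pi * exp 1 / saddle n * exp (pi\<^sup>2 / (8 * saddle n)) * exp (- 1 / (250 * saddle n))"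
proof -
  obtain \<epsilon> where \<epsilon>: "\<epsilon> > 0" "\<And>z. z \<in> sector \<Longrightarrow> norm z < \<epsilon> \<Longrightarrow>
    Re (gg_log (exp (- z)) - of_real (pi\<^sup>2) / (16 * z)) \<le> 1"
    using gg_log_sector_bound by blast
  obtain x0 where x0: "0 < x0" "\<And>x \<theta>. 0 < x \<Longrightarrow> x < x0 \<Longrightarrow> x \<le> \<bar>\<theta>\<bar> \<Longrightarrow> \<bar>\<theta>\<bar> \<le> pi \<Longrightarrow>
    Re (gg_log (exp (- Complex x \<theta>))) \<le> Re (gg_log (exp (- of_real x))) - 1 / (250 * x)"
    using gg_log_minor_arc by blast
  have "saddle \<longlonglongrightarrow> 0" using filterlim_saddle by (simp add: filterlim_at)
  then have "\<forall>\<^sub>F n in sequentially. saddle n < min 1 (min x0 \<epsilon>)"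
    by (rule order_tendstoD) (use \<epsilon> x0 in auto)
  moreover have "\<forall>\<^sub>F n in sequentially. 0 < n" by (rule eventually_gt_at_top)
  ultimately show ?thesis
  proof eventually_elim
    case (elim n)
    define x where "x = saddle n"
    have x: "0 < x" "x < 1" "x < x0" "x < \<epsilon>" using elim by (auto simp: x_def saddle_pos)
    define M where "M = exp (pi\<^sup>2 / (16 * x)) * (2 / x * exp (1 + pi\<^sup>2 / (16 * x) - 1 / (250 * x)))"
    have n: "real n * x = pi\<^sup>2 / (16 * x)"
      using of_nat_conv_saddle[OF elim(2)] x by (simp add: x_def[symmetric] power2_eq_square)
    have sector: "complex_of_real x \<in> sector" using x by (simp add: sector_def)
    have L: "Re (gg_log (exp (- of_real x))) \<le> 1 + pi\<^sup>2 / (16 * x)"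
    proof -
      have "of_real (pi\<^sup>2) / (16 * complex_of_real x) = of_real (pi\<^sup>2 / (16 * x))" by simp
      then have "Re (of_real (pi\<^sup>2) / (16 * complex_of_real x)) = pi\<^sup>2 / (16 * x)"
        by (simp only: Re_complex_of_real)
      moreover have "Re (gg_log (exp (- of_real x)) - of_real (pi\<^sup>2) / (16 * complex_of_real x)) \<le> 1"
        using x sector by (intro \<epsilon>(2)) auto
      ultimately show ?thesis by simp
    qed
    have int: "integrable lborel (gg_integrand a d n x)" by (intro gg_integrand_coeff x d)
    have "norm (\<integral>\<theta>. indicator (- {- x..x}) \<theta> *\<^sub>R gg_integrand a d n x \<theta> \<partial>lborel) \<le>
        (\<integral>\<theta>. M * indicator {- pi..pi} \<theta> \<partial>lborel)"
    proof (rule Bochner_Integration.integral_norm_bound_integral)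
      show "integrable lborel (\<lambda>\<theta>. indicator (- {- x..x}) \<theta> *\<^sub>R gg_integrand a d n x \<theta>)"
        by (intro integrable_mult_indicator int) auto
      show "integrable lborel (\<lambda>\<theta>. M * indicator {- pi..pi} \<theta>)" by simp
      fix \<theta> :: real
      show "norm (indicator (- {- x..x}) \<theta> *\<^sub>R gg_integrand a d n x \<theta>) \<le> M * indicator {- pi..pi} \<theta>"
      proof (cases "\<theta> \<in> {- pi..pi} \<and> \<theta> \<notin> {- x..x}")
        case True
        then have \<theta>: "x \<le> \<bar>\<theta>\<bar>" "\<bar>\<theta>\<bar> \<le> pi" by auto
        have "norm (exp (of_nat n * Complex x \<theta>)) = exp (real n * x)" by (simp add: norm_exp_eq_Re)
        moreover have "norm (gg_kernel a d (Complex x \<theta>)) \<le> 2 / x"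
          using x d by (intro norm_gg_kernel_le) auto
        moreover have "norm (exp (gg_log (exp (- Complex x \<theta>)))) \<le> exp (1 + pi\<^sup>2 / (16 * x) - 1 / (250 * x))"
          using x0(2)[OF x(1,3) \<theta>] L by (simp only: norm_exp_eq_Re exp_le_cancel_iff)
        ultimately have "norm (exp (of_nat n * Complex x \<theta>)) * (norm (gg_kernel a d (Complex x \<theta>)) *
            norm (exp (gg_log (exp (- Complex x \<theta>))))) \<le> M"
          unfolding M_def n[symmetric] using x by (intro mult_mono) auto
        then show ?thesis using True by (simp add: gg_integrand_def norm_mult)
      next
        case False
        have "0 \<le> M" using x by (simp add: M_def)
        then show ?thesis using False by (auto simp: gg_integrand_def indicator_def)
      qed
    qed
    also have "\<dots> = 2 * pi * M" by simp
    also have "M = 2 * exp 1 / x * (exp (pi\<^sup>2 / (16 * x)) * exp (pi\<^sup>2 / (16 * x))) * exp (- 1 / (250 * x))"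
      unfolding M_def by (simp add: exp_add exp_diff exp_minus field_simps)
    also have "exp (pi\<^sup>2 / (16 * x)) * exp (pi\<^sup>2 / (16 * x)) = exp (pi\<^sup>2 / (8 * x))"
      by (simp add: exp_add[symmetric])
    finally show ?case unfolding x_def by simp
  qed
qed

lemma tendsto_gg_sum_saddle:
  assumes d: "0 < d"
  shows "(\<lambda>n. 2 * pi * real (gg_sum a d n) / (sqrt (saddle n) * exp (pi\<^sup>2 / (8 * saddle n)))) \<longlonglongrightarrow>
    2 powr (- 1 / 4) / real d * (4 / sqrt pi)"
proof -
  let ?x = saddle
  \<comment> \<open>The natural size of the integral: the Jacobian x powr (3/2) of the substitution
    divided by the prefactor x exp (- pi^2 / (8 x)) of \<open>gg_rescaled\<close>.\<close>
  define K where "K n = sqrt (?x n) * exp (pi\<^sup>2 / (8 * ?x n))" for n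
  define minor where "minor n =
    (\<integral>\<theta>. indicator (- {- ?x n..?x n}) \<theta> *\<^sub>R gg_integrand a d n (?x n) \<theta> \<partial>lborel)" for n
  have evn: "\<forall>\<^sub>F n in sequentially. 0 < n" by (rule eventually_gt_at_top)
  have "(\<lambda>n. minor n / of_real (K n)) \<longlonglongrightarrow> 0"
  proof (rule Lim_null_comparison)
    show "\<forall>\<^sub>F n in sequentially. norm (minor n / of_real (K n)) \<le>
        4 * pi * exp 1 * (exp (- 1 / (250 * ?x n)) / (?x n * sqrt (?x n)))"
      using minor_arc_bound[OF d, of a] evn
    proof eventually_elim
      case (elim n)
      have K: "0 < K n" using elim(2) by (simp add: K_def saddle_pos)
      have "norm (minor n / of_real (K n)) \<le>
          4 * pi * exp 1 / ?x n * exp (pi\<^sup>2 / (8 * ?x n)) * exp (- 1 / (250 * ?x n)) / K n"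
        unfolding norm_divide norm_of_real minor_def using elim(1) K saddle_pos[OF elim(2)] by (intro frac_le) auto
      also have "\<dots> = 4 * pi * exp 1 * (exp (- 1 / (250 * ?x n)) / (?x n * sqrt (?x n)))"
        by (simp add: K_def)
      finally show ?case .
    qed
    have "((\<lambda>x :: real. 4 * pi * exp 1 * (exp (- 1 / (250 * x)) / (x * sqrt x))) \<longlongrightarrow> 0) (at_right 0)"
      by real_asymp
    then show "(\<lambda>n. 4 * pi * exp 1 * (exp (- 1 / (250 * ?x n)) / (?x n * sqrt (?x n)))) \<longlonglongrightarrow> 0"
      by (rule filterlim_compose[OF _ filterlim_saddle])
  qed
  from tendsto_add[OF tendsto_integral_gg_rescaled[OF d, of a] this]
  have "(\<lambda>n. (\<integral>u. gg_rescaled a d n u \<partial>lborel) + minor n / of_real (K n)) \<longlonglongrightarrow>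
      of_real (2 powr (- 1 / 4) / real d * (4 / sqrt pi))" by simp
  moreover have "\<forall>\<^sub>F n in sequentially. (\<integral>u. gg_rescaled a d n u \<partial>lborel) + minor n / of_real (K n) =
      of_real (2 * pi * real (gg_sum a d n) / K n)"
    using evn
  proof eventually_elim
    case (elim n)
    define x where "x = ?x n"
    have x: "0 < x" using elim by (simp add: x_def saddle_pos)
    define major where "major = (\<integral>\<theta>. indicator {- x..x} \<theta> *\<^sub>R gg_integrand a d n x \<theta> \<partial>lborel)"
    have int: "integrable lborel (gg_integrand a d n x)" by (intro gg_integrand_coeff x d)
    have "major = \<bar>x * sqrt x\<bar> *\<^sub>R (\<integral>u. indicator {- x..x} (0 + x * sqrt x * u) *\<^sub>R
        gg_integrand a d n x (0 + x * sqrt x * u) \<partial>lborel)"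
      unfolding major_def using x by (intro lborel_integral_real_affine) auto
    moreover have "(\<integral>u. gg_rescaled a d n u \<partial>lborel) = of_real (x * exp (- (pi\<^sup>2 / (8 * x)))) *
        (\<integral>u. indicator {- x..x} (x * sqrt x * u) *\<^sub>R gg_integrand a d n x (x * sqrt x * u) \<partial>lborel)"
      unfolding gg_rescaled_def Let_def x_def[symmetric] by (rule integral_mult_right_zero)
    moreover have "x * exp (- (pi\<^sup>2 / (8 * x))) = x * sqrt x / K n"
    proof -
      have "x * sqrt x / (sqrt x * e) = x * (1 / e)" for e :: real using x by simp
      then show ?thesis by (simp only: K_def x_def[symmetric] exp_minus inverse_eq_divide)
    qed
    then have "of_real (x * exp (- (pi\<^sup>2 / (8 * x)))) = of_real (x * sqrt x) / complex_of_real (K n)"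
      by (simp only: of_real_divide)
    ultimately have "(\<integral>u. gg_rescaled a d n u \<partial>lborel) = major / of_real (K n)"
      using x by (simp add: scaleR_conv_of_real)
    moreover have "major + minor n = (\<integral>\<theta>. gg_integrand a d n x \<theta> \<partial>lborel)"
    proof -
      have "major + minor n = (\<integral>\<theta>. indicator {- x..x} \<theta> *\<^sub>R gg_integrand a d n x \<theta> +
          indicator (- {- x..x}) \<theta> *\<^sub>R gg_integrand a d n x \<theta> \<partial>lborel)"
        unfolding major_def minor_def x_def[symmetric]
        by (intro Bochner_Integration.integral_add[symmetric] integrable_mult_indicator int) auto
      also have "\<dots> = (\<integral>\<theta>. gg_integrand a d n x \<theta> \<partial>lborel)"
        by (intro Bochner_Integration.integral_cong refl) (auto simp: indicator_def)
      finally show ?thesis .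
    qed
    moreover have "(\<integral>\<theta>. gg_integrand a d n x \<theta> \<partial>lborel) = 2 * of_real pi * of_nat (gg_sum a d n)"
      by (intro gg_integrand_coeff x d)
    ultimately show ?case by (simp add: add_divide_distrib[symmetric])
  qed
  ultimately have "(\<lambda>n. complex_of_real (2 * pi * real (gg_sum a d n) / K n)) \<longlonglongrightarrow>
      of_real (2 powr (- 1 / 4) / real d * (4 / sqrt pi))"
    by (rule Lim_transform_eventually)
  then show ?thesis unfolding tendsto_of_real_iff K_def .
qed

section \<open>Translation back to n\<close>

definition gg_growth :: "nat \<Rightarrow> real" where
  "gg_growth n = real n powr (- 1 / 4) * exp (pi / 2 * sqrt (real n))"

lemma tendsto_gg_sum:
  assumes d: "0 < d"
  shows "(\<lambda>n. real (gg_sum a d n) / gg_growth n) \<longlonglongrightarrow> 2 powr (- 1 / 4) / pi / real d"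
proof -
  \<comment> \<open>The factor 1 / (4 sqrt pi) is (sqrt pi / 2) / (2 pi): it undoes the 2 pi of
    Cauchy's formula and the constant in sqrt (saddle n) = (sqrt pi / 2) n powr (- 1/4).\<close>
  have "(\<lambda>n. 2 * pi * real (gg_sum a d n) / (sqrt (saddle n) * exp (pi\<^sup>2 / (8 * saddle n))) * (1 / (4 * sqrt pi)))
      \<longlonglongrightarrow> 2 powr (- 1 / 4) / real d * (4 / sqrt pi) * (1 / (4 * sqrt pi))"
    by (intro tendsto_mult tendsto_const tendsto_gg_sum_saddle d)
  also have "2 powr (- 1 / 4) / real d * (4 / sqrt pi) * (1 / (4 * sqrt pi)) = 2 powr (- 1 / 4) / pi / real d"
    by simp
  finally show ?thesis
  proof (rule Lim_transform_eventually)
    show "\<forall>\<^sub>F n in sequentially. 2 * pi * real (gg_sum a d n) / (sqrt (saddle n) * exp (pi\<^sup>2 / (8 * saddle n))) *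
        (1 / (4 * sqrt pi)) = real (gg_sum a d n) / gg_growth n"
      using eventually_gt_at_top[of 0]
    proof eventually_elim
      case (elim n)
      have "sqrt (sqrt (real n)) = real n powr (1 / 4)"
      proof -
        have "real n powr (1 / 4) = (real n powr (1 / 2)) powr (1 / 2)" by (simp only: powr_powr) simp
        then show ?thesis by (simp add: powr_half_sqrt)
      qed
      then have "sqrt (saddle n) = sqrt pi / 2 * real n powr (- 1 / 4)"
        using powr_minus_divide[of "real n" "1 / 4"] by (simp add: saddle_def real_sqrt_divide real_sqrt_mult)
      moreover have "pi\<^sup>2 / (8 * saddle n) = pi / 2 * sqrt (real n)"
        using elim by (simp add: saddle_def power2_eq_square)
      ultimately have K: "sqrt (saddle n) * exp (pi\<^sup>2 / (8 * saddle n)) = sqrt pi / 2 * gg_growth n"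
        by (simp only: gg_growth_def mult.assoc)
      have "2 * pi * t / (s / 2 * G) * (1 / (4 * s)) = pi / (s * s) * (t / G)" for s t G :: real
        by (cases "s = 0"; cases "G = 0") (simp_all add: divide_simps)
      moreover have "pi / (sqrt pi * sqrt pi) = 1" by simp
      ultimately show ?case unfolding K by (simp only: mult_1_left)
    qed
  qed
qed

lemma gg_growth_asymp_equivI:
  assumes "(\<lambda>n. real (f n) / gg_growth n) \<longlonglongrightarrow> c" "c \<noteq> 0"
  shows "(\<lambda>n. real (f n)) \<sim>[at_top] (\<lambda>n. c * real n powr (- 1 / 4) * exp (pi / 2 * sqrt (real n)))"
  using asymp_equivI'_const[OF assms] by (simp add: gg_growth_def mult.assoc)

theorem theorem1p7:
  "(\<lambda>n. real (g2 1 n)) \<sim>[at_top]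
     (\<lambda>n. 3 / (2 powr (13/4) * pi) * real n powr (-1/4) * exp (pi / 2 * sqrt (real n)))
   \<and> (\<lambda>n. real (g2 2 n)) \<sim>[at_top]
     (\<lambda>n. 1 / (2 powr (5/4) * pi) * real n powr (-1/4) * exp (pi / 2 * sqrt (real n)))"
proof
  let ?c = "2 powr (- 1 / 4) / pi :: real"
  let ?r = "\<lambda>a d n. real (gg_sum a d n) / gg_growth n"
  have "(\<lambda>n. ?r 1 8 n + ?r 5 8 n + ?r 6 8 n) \<longlonglongrightarrow> ?c / real 8 + ?c / real 8 + ?c / real 8"
    by (intro tendsto_add tendsto_gg_sum) auto
  also have "(\<lambda>n. ?r 1 8 n + ?r 5 8 n + ?r 6 8 n) = (\<lambda>n. real (g2 1 n) / gg_growth n)"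
    unfolding g2_1 by (simp add: add_divide_distrib)
  also have "?c / real 8 + ?c / real 8 + ?c / real 8 = 3 / (2 powr (13/4) * pi)"
  proof -
    have "2 powr (13 / 4) = 2 powr (1 / 4) * (2 powr 3 :: real)" by (simp only: powr_add[symmetric]) simp
    then show ?thesis by (simp add: powr_minus field_simps)
  qed
  finally show "(\<lambda>n. real (g2 1 n)) \<sim>[at_top]
     (\<lambda>n. 3 / (2 powr (13/4) * pi) * real n powr (-1/4) * exp (pi / 2 * sqrt (real n)))"
    by (rule gg_growth_asymp_equivI) simp
  \<comment> \<open>The coefficients add up to 3/16 + 3/8 - 1/16 = 1/2, and half of 2 powr (- 1/4)
    is 2 powr (- 5/4).\<close>
  have "(\<lambda>n. ?r 2 16 n + ?r 10 16 n + ?r 12 16 n + ?r 9 8 n + ?r 5 8 n + ?r 6 8 n - ?r 11 16 n) \<longlonglongrightarrow>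
      ?c / real 16 + ?c / real 16 + ?c / real 16 + ?c / real 8 + ?c / real 8 + ?c / real 8 - ?c / real 16"
    by (intro tendsto_add tendsto_diff tendsto_gg_sum) auto
  also have "(\<lambda>n. ?r 2 16 n + ?r 10 16 n + ?r 12 16 n + ?r 9 8 n + ?r 5 8 n + ?r 6 8 n - ?r 11 16 n) =
      (\<lambda>n. real (g2 2 n) / gg_growth n)"
  proof
    fix n
    have "real (g2 2 n) = real (gg_sum 2 16 n) + real (gg_sum 10 16 n) + real (gg_sum 12 16 n) +
        real (gg_sum 9 8 n) + real (gg_sum 5 8 n) + real (gg_sum 6 8 n) - real (gg_sum 11 16 n)"
      using arg_cong[OF g2_2[of n], of real] by simp
    then show "?r 2 16 n + ?r 10 16 n + ?r 12 16 n + ?r 9 8 n + ?r 5 8 n + ?r 6 8 n - ?r 11 16 n =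
        real (g2 2 n) / gg_growth n"
      by (simp only: add_divide_distrib diff_divide_distrib)
  qed
  also have "?c / real 16 + ?c / real 16 + ?c / real 16 + ?c / real 8 + ?c / real 8 + ?c / real 8 - ?c / real 16 =
      1 / (2 powr (5/4) * pi)"
  proof -
    have "2 powr (5 / 4) = 2 powr (1 / 4) * (2 powr 1 :: real)" by (simp only: powr_add[symmetric]) simp
    then show ?thesis by (simp add: powr_minus field_simps)
  qed
  finally show "(\<lambda>n. real (g2 2 n)) \<sim>[at_top]
     (\<lambda>n. 1 / (2 powr (5/4) * pi) * real n powr (-1/4) * exp (pi / 2 * sqrt (real n)))"
    by (rule gg_growth_asymp_equivI) simp
qed

end
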